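(* Let $\lambda$ be a regular cardinal such that $\kappa^\omega<\lambda$ for every cardinal $\kappa<\lambda$. Let $(\Omega,\Sigma,L_P)$ be a hyperfinite Loeb space (in some nonstandard universe) with $|\Omega|=\lambda$. Then $\Omega$ is not compact.
   Context: Work in ZFC. The standard universe $V$ is built over $\mathbb{N}$: $V_0=\mathbb{N}$, $V_{n+1}=V_n\cup\mathcal{P}(V_n)$, $V=\bigcup_n V_n$. A nonstandard universe ${}^*V$ is the truncation at ${}^*\!\in$-rank $\omega$ of an elementary extension of $(V,\in)$ with ${}^*\mathbb{N}\setminus\mathbb{N}\neq\emptyset$, always assumed $\omega_1$-saturated. A hyperfinite Loeb space: for $H\in{}^*\mathbb{N}\setminus\mathbb{N}$, $\Omega=\{1,\dots,H\}$, $P(A)={}^*|A|/H$ for internal $A\subseteq\Omega$; $(\Omega,\Sigma,L_P)$ is the Loeb measure space generated by the internal subsets and $\mathrm{st}\circ P$ (completed). $|\Omega|$ denotes external cardinality. A family $\mathcal{C}\subseteq\Sigma$ is compact if every subfamily with the finite intersection property has nonempty intersection, and inner-regular if $L_P(A)=\sup\{L_P(C):C\subseteq A,\ C\in\mathcal{C}\}$ for all $A\in\Sigma$. $\Omega$ is compact if it carries an inner-regular compact family. *)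

theory Defs
  imports "HOL-Analysis.Analysis"
begin

unbundle cardinal_syntax

datatype fm = Mem nat nat | Eq nat nat | Neg fm | Conj fm fm | Ex nat fm

primrec sat :: "('a \<Rightarrow> 'a \<Rightarrow> bool) \<Rightarrow> fm \<Rightarrow> (nat \<Rightarrow> 'a) \<Rightarrow> bool" where
  "sat R (Mem i k) v \<longleftrightarrow> R (v i) (v k)"
| "sat R (Eq i k) v \<longleftrightarrow> v i = v k"
| "sat R (Neg f) v \<longleftrightarrow> \<not> sat R f v"
| "sat R (Conj f g) v \<longleftrightarrow> sat R f v \<and> sat R g v"
| "sat R (Ex i f) v \<longleftrightarrow> (\<exists>x. sat R f (v(i := x)))"

definition elementary_embedding ::
  "('a \<Rightarrow> 'a \<Rightarrow> bool) \<Rightarrow> ('b \<Rightarrow> 'b \<Rightarrow> bool) \<Rightarrow> ('a \<Rightarrow> 'b) \<Rightarrow> bool" where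
  "elementary_embedding R S h \<longleftrightarrow> (\<forall>f v. sat R f v \<longleftrightarrow> sat S f (h \<circ> v))"

text \<open>The second argument \<open>U\<close> is the set of urelements of the structure \<open>R\<close>. The urelements
  have no members, so they must be excluded when the empty set is picked out by its members.\<close>

definition ext :: "('a \<Rightarrow> 'a \<Rightarrow> bool) \<Rightarrow> 'a \<Rightarrow> 'a set" where
  "ext R x = {y. R y x}"

definition mkset :: "('a \<Rightarrow> 'a \<Rightarrow> bool) \<Rightarrow> 'a set \<Rightarrow> 'a set \<Rightarrow> 'a" where
  "mkset R U A = (THE x. x \<notin> U \<and> ext R x = A)"

definition opair :: "('a \<Rightarrow> 'a \<Rightarrow> bool) \<Rightarrow> 'a set \<Rightarrow> 'a \<Rightarrow> 'a \<Rightarrow> 'a" where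
  "opair R U x y = mkset R U {mkset R U {x}, mkset R U {x, y}}"

definition holds :: "('a \<Rightarrow> 'a \<Rightarrow> bool) \<Rightarrow> 'a set \<Rightarrow> 'a \<Rightarrow> 'a \<Rightarrow> 'a \<Rightarrow> bool" where
  "holds R U r x y \<longleftrightarrow> R (opair R U x y) r"

definition app :: "('a \<Rightarrow> 'a \<Rightarrow> bool) \<Rightarrow> 'a set \<Rightarrow> 'a \<Rightarrow> 'a \<Rightarrow> 'a" where
  "app R U f x = (THE y. holds R U f x y)"

text \<open>The levels of the cumulative hierarchy over \<open>range \<nu>\<close>, where \<open>\<nu>\<close> enumerates the natural
  numbers, as external sets.\<close>

primrec level :: "('v \<Rightarrow> 'v \<Rightarrow> bool) \<Rightarrow> (nat \<Rightarrow> 'v) \<Rightarrow> nat \<Rightarrow> 'v set" where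
  "level E \<nu> 0 = range \<nu>"
| "level E \<nu> (Suc n) = level E \<nu> n \<union> {x. x \<notin> range \<nu> \<and> ext E x \<subseteq> level E \<nu> n}"

text \<open>The axioms determine \<open>('v, E)\<close> up to isomorphism as the superstructure over the natural
  numbers: \<open>full\<close> says that every external subset of a level is an element of the universe,
  so \<open>level E \<nu> (Suc n)\<close> is the union of \<open>level E \<nu> n\<close> and its true power set.\<close>

locale standard_universe =
  fixes E :: "'v \<Rightarrow> 'v \<Rightarrow> bool"
    and \<nu> :: "nat \<Rightarrow> 'v"
  assumes inj_nu: "inj \<nu>"
    and urelement: "ext E (\<nu> n) = {}"
    and extensional: "x \<notin> range \<nu> \<Longrightarrow> y \<notin> range \<nu> \<Longrightarrow> ext E x = ext E y \<Longrightarrow> x = y"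
    and full: "A \<subseteq> level E \<nu> n \<Longrightarrow> \<exists>x. x \<notin> range \<nu> \<and> ext E x = A"
    and exhaustive: "(\<Union>n. level E \<nu> n) = UNIV"
begin

abbreviation vset :: "'v set \<Rightarrow> 'v" where
  "vset \<equiv> mkset E (range \<nu>)"

abbreviation vpair :: "'v \<Rightarrow> 'v \<Rightarrow> 'v" where
  "vpair \<equiv> opair E (range \<nu>)"

definition vlevel :: "nat \<Rightarrow> 'v" where
  "vlevel n = vset (level E \<nu> n)"

definition vnat :: 'v where
  "vnat = vset (range \<nu>)"

definition vnat_le :: 'v where
  "vnat_le = vset {vpair (\<nu> m) (\<nu> n) | m n. m \<le> n}"

definition vcard :: 'v where
  "vcard = vset {vpair (vset (\<nu> ` S)) (\<nu> (card S)) | S. finite S}"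

text \<open>Real numbers are represented by their Dedekind cuts, with the rationals numbered by
  \<open>to_nat\<close>.\<close>

definition vreal :: "real \<Rightarrow> 'v" where
  "vreal r = vset {\<nu> (to_nat q) | q :: rat. of_rat q < r}"

definition vreal_less :: 'v where
  "vreal_less = vset {vpair (vreal r) (vreal s) | r s. r < s}"

definition vquotient :: 'v where
  "vquotient =
     vset {vpair (vpair (\<nu> m) (\<nu> n)) (vreal (real m / real n)) | m n. n > 0}"

end

definition fip :: "'a set set \<Rightarrow> bool" where
  "fip D \<longleftrightarrow> (\<forall>X. finite X \<longrightarrow> X \<noteq> {} \<longrightarrow> X \<subseteq> D \<longrightarrow> \<Inter>X \<noteq> {})"

locale elementary_extension = standard_universe E \<nu>
  for E :: "'v \<Rightarrow> 'v \<Rightarrow> bool" and \<nu> :: "nat \<Rightarrow> 'v" +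
  fixes F :: "'w \<Rightarrow> 'w \<Rightarrow> bool"
    and star :: "'v \<Rightarrow> 'w"
  assumes elementary: "elementary_embedding E F star"
begin

text \<open>The type \<open>'w\<close> carries the whole elementary extension; the nonstandard universe is its
  truncation, which consists of the elements of finite standard rank.\<close>

definition nonstandard_part :: "'w set" where
  "nonstandard_part = (\<Union>n. ext F (star (vlevel n)))"

definition hypernats :: "'w set" where
  "hypernats = ext F (star vnat)"

definition infinite_hypernats :: "'w set" where
  "infinite_hypernats = hypernats - star ` range \<nu>"

definition internal :: "'w set \<Rightarrow> bool" where
  "internal A \<longleftrightarrow> (\<exists>a \<in> nonstandard_part - hypernats. A = ext F a)"

end

locale nonstandard_universe = elementary_extension E \<nu> F star
  for E :: "'v \<Rightarrow> 'v \<Rightarrow> bool" and \<nu> :: "nat \<Rightarrow> 'v"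
    and F :: "'w \<Rightarrow> 'w \<Rightarrow> bool" and star :: "'v \<Rightarrow> 'w" +
  assumes nonstandard: "infinite_hypernats \<noteq> {}"
    and omega1_saturated:
      "countable D \<Longrightarrow> \<forall>A\<in>D. internal A \<Longrightarrow> fip D \<Longrightarrow> \<Inter>D \<noteq> {}"
begin

abbreviation wset :: "'w set \<Rightarrow> 'w" where
  "wset \<equiv> mkset F hypernats"

abbreviation wpair :: "'w \<Rightarrow> 'w \<Rightarrow> 'w" where
  "wpair \<equiv> opair F hypernats"

definition star_le :: "'w \<Rightarrow> 'w \<Rightarrow> bool" where
  "star_le x y \<longleftrightarrow> holds F hypernats (star vnat_le) x y"

definition star_less :: "'w \<Rightarrow> 'w \<Rightarrow> bool" where
  "star_less x y \<longleftrightarrow> holds F hypernats (star vreal_less) x y"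

definition internal_card :: "'w set \<Rightarrow> 'w" where
  "internal_card A = app F hypernats (star vcard) (wset A)"

definition star_quotient :: "'w \<Rightarrow> 'w \<Rightarrow> 'w" where
  "star_quotient x y = app F hypernats (star vquotient) (wpair x y)"

text \<open>The standard part of a finite hyperreal \<open>x\<close>; the value on other arguments is
  irrelevant.\<close>

definition st :: "'w \<Rightarrow> real" where
  "st x = (THE r. \<forall>e>0. star_less (star (vreal (r - e))) x \<and>
                        star_less x (star (vreal (r + e))))"

definition hyperfinite :: "'w \<Rightarrow> 'w set" where
  "hyperfinite H = {x \<in> hypernats. star_le (star (\<nu> 1)) x \<and> star_le x H}"

definition internal_prob :: "'w \<Rightarrow> 'w set \<Rightarrow> 'w" where
  "internal_prob H A = star_quotient (internal_card A) H"

text \<open>By saturation the premeasure extends to the generated sigma algebra, uniquely since it is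
  finite, so the choice made by \<open>extend_measure\<close> does not matter.\<close>

definition loeb_space :: "'w \<Rightarrow> 'w measure" where
  "loeb_space H = completion
     (extend_measure (hyperfinite H) {A. internal A \<and> A \<subseteq> hyperfinite H} (\<lambda>A. A)
        (\<lambda>A. ennreal (st (internal_prob H A))))"

end

definition compact_family :: "'a set set \<Rightarrow> bool" where
  "compact_family C \<longleftrightarrow> (\<forall>D \<subseteq> C. fip D \<longrightarrow> \<Inter>D \<noteq> {})"

definition inner_regular_family :: "'a measure \<Rightarrow> 'a set set \<Rightarrow> bool" where
  "inner_regular_family M C \<longleftrightarrow>
     (\<forall>A \<in> sets M. emeasure M A = (SUP K \<in> {K \<in> C. K \<subseteq> A}. emeasure M K))"

definition compact_measure_space :: "'a measure \<Rightarrow> bool" where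
  "compact_measure_space M \<longleftrightarrow>
     (\<exists>C \<subseteq> sets M. compact_family C \<and> inner_regular_family M C)"

end

theory Submission
  imports Defs
begin

text \<open>Call a set small if it has fewer than \<open>\<lambda>\<close> elements. The Walsh functions give \<open>\<lambda>\<close> many internal
  subsets of \<open>\<Omega>\<close> of which any three contain two at Loeb distance at least \<open>1 / 4\<close>, so that a small
  family of measurable sets stays away from one of them. Suppose \<open>C\<close> is a compact inner-regular family
  and approximate each Walsh set and its complement from inside by members \<open>C0 i\<close>, \<open>C1 i\<close> of \<open>C\<close>. If
  there are \<open>\<lambda>\<close> many \<open>i\<close> for which all finite Boolean combinations of these pairs have positive
  measure, then compactness produces \<open>2\<^sup>\<lambda>\<close> points of \<open>\<Omega>\<close>, which is absurd. So for each measurable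
  \<open>B\<close> of positive measure, a maximal set \<open>T B\<close> of indices that are independent inside \<open>B\<close> is small.
  As \<open>\<kappa>\<^sup>\<omega> < \<lambda>\<close> for all \<open>\<kappa> < \<lambda>\<close>, there is a small sigma-algebra that contains the pairs indexed
  by \<open>T B\<close> whenever it contains \<open>B\<close>. A Walsh set far from this sigma-algebra then extends \<open>T B\<close> for a
  suitable \<open>B\<close>, against maximality.\<close>

section \<open>Cardinals closed under countable powers\<close>

locale regular_omega_closed =
  fixes r :: "'l rel"
  assumes Cinfinite: "Cinfinite r" and regular: "regularCard r"
    and power_less: "\<forall>\<kappa> :: 'l rel. Card_order \<kappa> \<and> \<kappa> <o r \<longrightarrow> \<kappa> ^c natLeq <o r"
begin

lemma small_mono: "|A| <o r \<Longrightarrow> B \<subseteq> A \<Longrightarrow> |B| <o r"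
  using card_of_mono1 ordLeq_ordLess_trans by blast

lemma small_image: "|A| <o r \<Longrightarrow> |f ` A| <o r"
  using card_of_image ordLeq_ordLess_trans by blast

lemma small_finite: "finite A \<Longrightarrow> |A| <o r"
  using Cinfinite Cfinite_ordLess_Cinfinite[of "|A|" r] card_of_Card_order
  by (auto simp: cfinite_def Field_card_of)

lemma small_UN: "|I| <o r \<Longrightarrow> (\<And>i. i \<in> I \<Longrightarrow> |A i| <o r) \<Longrightarrow> |\<Union>i\<in>I. A i| <o r"
  using card_of_UNION_ordLess_infinite_Field_regularCard[OF regular Cinfinite] by blast

lemma small_sequences:
  fixes A :: "'b set"
  assumes "|A| <o r"
  shows "|{s :: nat \<Rightarrow> 'b. range s \<subseteq> A}| <o r"
proof -
  \<comment> \<open>\<open>power_less\<close> speaks only of cardinals on the type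
    \<open>'l\<close>, so \<open>A\<close> is first injected into that type.\<close>
  have "|A| \<le>o |Field r|"
    using ordLeq_ordIso_trans[OF ordLess_imp_ordLeq[OF assms]]
      ordIso_symmetric[OF card_of_Field_ordIso] Cinfinite by blast
  then obtain g :: "'b \<Rightarrow> 'l" where g: "inj_on g A"
    by (auto simp: card_of_ordLeq[symmetric])
  have "|g ` A| ^c natLeq <o r"
    using power_less small_image[OF assms, of g] card_of_Card_order[of "g ` A"] by simp
  then have small: "|Func (UNIV :: nat set) (g ` A)| <o r"
    by (simp add: cexp_def Field_natLeq Field_card_of)
  have "inj_on (\<lambda>s. g \<circ> s) {s :: nat \<Rightarrow> 'b. range s \<subseteq> A}"
  proof (rule inj_onI)
    fix s t :: "nat \<Rightarrow> 'b"
    assume st: "s \<in> {s. range s \<subseteq> A}" "t \<in> {s. range s \<subseteq> A}" "g \<circ> s = g \<circ> t"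
    show "s = t"
    proof
      fix n
      have "g (s n) = g (t n)" using fun_cong[OF st(3), of n] by simp
      then show "s n = t n" using st(1,2) by (intro inj_onD[OF g]) auto
    qed
  qed
  moreover have "(\<lambda>s. g \<circ> s) ` {s :: nat \<Rightarrow> 'b. range s \<subseteq> A} \<subseteq> Func UNIV (g ` A)"
    unfolding Func_def by fastforce
  ultimately have "|{s :: nat \<Rightarrow> 'b. range s \<subseteq> A}| \<le>o |Func (UNIV :: nat set) (g ` A)|"
    by (intro card_of_ordLeqI[of "\<lambda>s. g \<circ> s"]) auto
  then show ?thesis
    by (rule ordLeq_ordLess_trans[OF _ small])
qed

end

datatype btree = Tip | Branch "nat \<Rightarrow> btree"

text \<open>The addresses of the \<open>Branch\<close> nodes. They lie in a countable type, so a
  tree that is determined by them is coded by a subset of a countable set.\<close>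

primrec nodes :: "btree \<Rightarrow> nat list set" where
  "nodes Tip = {}"
| "nodes (Branch s) = insert [] (\<Union>n. (#) n ` nodes (s n))"

primrec iterate_tree :: "('b set \<Rightarrow> 'b set) \<Rightarrow> btree \<Rightarrow> 'b set" where
  "iterate_tree step Tip = {}"
| "iterate_tree step (Branch s) = step (\<Union>n. iterate_tree step (s n))"

lemma inj_nodes: "inj nodes"
proof (rule injI)
  fix t u :: btree
  show "nodes t = nodes u \<Longrightarrow> t = u"
  proof (induction t arbitrary: u)
    case Tip
    then show ?case by (cases u) auto
  next
    case (Branch s)
    then obtain s' where u: "u = Branch s'" by (cases u) auto
    \<comment> \<open>The nodes of a subtree are read off from those of the whole tree by stripping
      the first entry of the addresses.\<close>
    have sub: "nodes (q n) = {p. n # p \<in> nodes (Branch q)}" for n q by auto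
    have "nodes (s n) = nodes (s' n)" for n
      using Branch.prems unfolding u by (simp only: sub)
    then have "s n = s' n" for n by (rule Branch.IH[OF rangeI])
    then show ?case unfolding u by auto
  qed
qed

context regular_omega_closed
begin

text \<open>A tree is coded by the characteristic function of its node set along an enumeration of
  \<open>nat list\<close>. The set of binary sequences is small by \<open>small_sequences\<close>,
  as \<open>bool\<close> is finite.\<close>

lemma small_btree: "|UNIV :: btree set| <o r"
proof -
  have "|{s :: nat \<Rightarrow> bool. range s \<subseteq> UNIV}| <o r"
    by (rule small_sequences) (simp add: small_finite)
  moreover have "inj (\<lambda>t n. from_nat n \<in> nodes t)"
  proof (rule injI)
    fix t u assume "(\<lambda>n. from_nat n \<in> nodes t) = (\<lambda>n. from_nat n \<in> nodes u)"
    then have "from_nat (to_nat p) \<in> nodes t \<longleftrightarrow> from_nat (to_nat p) \<in> nodes u" for p :: "nat list"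
      by meson
    then have "nodes t = nodes u" by auto
    then show "t = u" using inj_nodes by (simp add: inj_eq)
  qed
  then have "|UNIV :: btree set| \<le>o |{s :: nat \<Rightarrow> bool. range s \<subseteq> UNIV}|"
    by (rule card_of_ordLeqI) auto
  ultimately show ?thesis
    using ordLeq_ordLess_trans by blast
qed

text \<open>Iterating \<open>step\<close> along the \<open>2\<^sup>\<omega>\<close> many well-founded countably branching trees replaces
  an iteration of length \<open>\<omega>\<^sub>1\<close>: members of \<open>Z\<close> that arise at the trees \<open>t 0, t 1, \<dots>\<close> are
  all available at the tree \<open>Branch t\<close>.\<close>

lemma small_closure:
  fixes step :: "'b set \<Rightarrow> 'b set"
  assumes step: "\<And>A. |A| <o r \<Longrightarrow> |step A| <o r"
  obtains Z where "|Z| <o r" "step {} \<subseteq> Z"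
    "\<And>s :: nat \<Rightarrow> 'b. range s \<subseteq> Z \<Longrightarrow> \<exists>A. range s \<subseteq> A \<and> step A \<subseteq> Z"
proof -
  define G where "G = iterate_tree step"
  have G_simps: "G Tip = {}" "\<And>s. G (Branch s) = step (\<Union>n. G (s n))"
    by (simp_all add: G_def)
  \<comment> \<open>A number n is coded by the tree whose only nontrivial subtree hangs at n, so
    smallness passes from \<open>btree\<close> to \<open>nat\<close>.\<close>
  have nat: "|UNIV :: nat set| <o r"
  proof -
    let ?f = "\<lambda>n::nat. Branch (\<lambda>m. if m = n then Branch (\<lambda>_. Tip) else Tip)"
    have "inj ?f"
    proof (rule injI)
      fix m n assume "?f m = ?f n"
      then have "(if m = m then Branch (\<lambda>_. Tip) else Tip) = (if m = n then Branch (\<lambda>_. Tip) else Tip)"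
        by (simp only: btree.inject fun_eq_iff)
      then show "m = n" by (simp split: if_splits)
    qed
    then have "|UNIV :: nat set| \<le>o |UNIV :: btree set|"
      by (intro card_of_ordLeqI[of ?f]) auto
    then show ?thesis
      by (rule ordLeq_ordLess_trans[OF _ small_btree])
  qed
  have G: "|G t| <o r" for t
  proof (induction t)
    case Tip
    then show ?case by (simp add: G_simps small_finite)
  next
    case (Branch s)
    then show ?case
      unfolding G_simps by (intro step small_UN nat) auto
  qed
  show thesis
  proof (rule that[of "\<Union>t. G t"])
    show "|\<Union>t. G t| <o r"
      by (intro small_UN small_btree G)
    have "step {} \<subseteq> G (Branch (\<lambda>_. Tip))" by (simp add: G_simps)
    then show "step {} \<subseteq> (\<Union>t. G t)" by blast
    fix s :: "nat \<Rightarrow> 'b" assume "range s \<subseteq> (\<Union>t. G t)"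
    then have "\<forall>n. \<exists>t. s n \<in> G t" by auto
    then obtain t where "\<And>n. s n \<in> G (t n)" by metis
    then have "range s \<subseteq> (\<Union>n. G (t n))" "step (\<Union>n. G (t n)) \<subseteq> (\<Union>t. G t)"
      using G_simps(2)[of t] by blast+
    then show "\<exists>A. range s \<subseteq> A \<and> step A \<subseteq> (\<Union>t. G t)" by blast
  qed
qed

end

text \<open>Exhaustion: a sequence in \<open>N\<close> whose measures approach their supremum has a
  union of at least that measure. A member \<open>B\<close> with a positive part outside this union
  would push \<open>A \<union> B\<close> beyond the supremum.\<close>

lemma (in finite_measure) essential_maximum:
  assumes "N \<noteq> {}" "N \<subseteq> sets M" and UN: "\<And>s :: nat \<Rightarrow> 'a set. range s \<subseteq> N \<Longrightarrow> (\<Union>n. s n) \<in> N"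
  obtains A where "A \<in> N" "\<And>B. B \<in> N \<Longrightarrow> measure M (B - A) = 0"
proof -
  have bdd: "bdd_above (measure M ` N)"
    by (intro bdd_aboveI2[of _ _ "measure M (space M)"] bounded_measure)
  define m where "m = (SUP B\<in>N. measure M B)"
  have "\<exists>B\<in>N. m - 1 / Suc n < measure M B" for n
    unfolding m_def using assms(1) bdd by (subst less_cSUP_iff[symmetric]) auto
  then obtain s where s: "\<And>n. s n \<in> N" "\<And>n. m - 1 / Suc n < measure M (s n)"
    by metis
  define A where "A = (\<Union>n. s n)"
  have A: "A \<in> N" unfolding A_def using s by (intro UN) auto
  have mA: "m \<le> measure M A"
  proof (rule field_le_epsilon)
    fix e :: real assume "e > 0"
    then obtain n where "1 / Suc n < e" using nat_approx_posE by blast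
    moreover have "measure M (s n) \<le> measure M A"
      using A s assms(2) by (intro finite_measure_mono) (auto simp: A_def)
    ultimately show "m \<le> measure M A + e" using s(2)[of n] by linarith
  qed
  show thesis
  proof (rule that[OF A])
    fix B assume B: "B \<in> N"
    have "(\<Union>n::nat. (if n = 0 then A else B)) \<in> N"
      using A B by (intro UN) auto
    moreover have "(\<Union>n::nat. (if n = 0 then A else B)) = A \<union> B"
      by (auto split: if_splits)
    ultimately have "A \<union> B \<in> N" by simp
    then have "measure M (A \<union> B) \<le> m"
      unfolding m_def using bdd by (intro cSUP_upper)
    moreover have "measure M (A \<union> B) = measure M A + measure M (B - A)"
      using A B assms(2) by (subst finite_measure_Union[symmetric]) auto
    ultimately show "measure M (B - A) = 0"
      using mA measure_nonneg[of M "B - A"] by linarith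
  qed
qed

section \<open>Compactness and independent families\<close>

text \<open>If \<open>A\<close> is null, \<open>C\<close> may have no member inside
  \<open>A\<close>, because the supremum of the empty set is 0 in \<open>ennreal\<close>. The empty
  set is added to cover this case.\<close>

lemma inner_regular_approx:
  assumes "finite_measure M" "inner_regular_family M C" "C \<subseteq> sets M" "A \<in> sets M" "e > 0"
  shows "\<exists>K \<in> insert {} C. K \<subseteq> A \<and> measure M A - e < measure M K"
proof (cases "measure M A - e < 0")
  case True
  then show ?thesis by (intro bexI[of _ "{}"]) auto
next
  case False
  interpret finite_measure M by fact
  have "ennreal (measure M A - e) < emeasure M A"
    using False \<open>e > 0\<close> by (simp add: emeasure_eq_measure ennreal_less_iff)
  also have "emeasure M A = (SUP K \<in> {K \<in> C. K \<subseteq> A}. emeasure M K)"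
    using assms(2,4) by (simp add: inner_regular_family_def)
  finally obtain K where "K \<in> C" "K \<subseteq> A" "ennreal (measure M A - e) < emeasure M K"
    by (auto simp: less_SUP_iff)
  then show ?thesis
    using False by (intro bexI[of _ K]) (auto simp: emeasure_eq_measure ennreal_less_iff)
qed

lemma compact_family_insert_empty: "compact_family C \<Longrightarrow> compact_family (insert {} C)"
  unfolding compact_family_def
proof (intro allI impI)
  fix D :: "'a set set"
  assume C: "\<forall>D\<subseteq>C. fip D \<longrightarrow> \<Inter> D \<noteq> {}" and D: "D \<subseteq> insert {} C" "fip D"
  have "{} \<notin> D"
  proof
    assume "{} \<in> D"
    then show False using D(2)[unfolded fip_def, rule_format, of "{{}}"] by simp
  qed
  then have "D \<subseteq> C" using D(1) by blast
  then show "\<Inter> D \<noteq> {}" using C D(2) by simp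
qed

text \<open>\<open>C0 i\<close> and \<open>C1 i\<close> play the roles of a set and its complement
  but need not cover the space. The choice \<open>F0 = F1 = {}\<close> includes the demand that
  \<open>B\<close> itself has positive measure.\<close>

definition independent_in :: "'a measure \<Rightarrow> ('i \<Rightarrow> 'a set) \<Rightarrow> ('i \<Rightarrow> 'a set) \<Rightarrow> 'a set \<Rightarrow> 'i set \<Rightarrow> bool"
  where "independent_in M C0 C1 B T \<longleftrightarrow>
    (\<forall>F0 F1. finite F0 \<longrightarrow> finite F1 \<longrightarrow> F0 \<union> F1 \<subseteq> T \<longrightarrow> F0 \<inter> F1 = {} \<longrightarrow>
      measure M (B \<inter> (\<Inter>i\<in>F0. C0 i) \<inter> (\<Inter>i\<in>F1. C1 i)) > 0)"

lemma independent_inD: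
  "independent_in M C0 C1 B T \<Longrightarrow> finite F0 \<Longrightarrow> finite F1 \<Longrightarrow> F0 \<union> F1 \<subseteq> T \<Longrightarrow> F0 \<inter> F1 = {} \<Longrightarrow>
      measure M (B \<inter> (\<Inter>i\<in>F0. C0 i) \<inter> (\<Inter>i\<in>F1. C1 i)) > 0"
  unfolding independent_in_def by blast

text \<open>Independence has finite character: each condition on the union of a chain involves
  finitely many indices and so already concerns one member of the chain. Hence Zorn's lemma
  applies.\<close>

lemma maximal_independent_exists:
  assumes "measure M B > 0"
  shows "\<exists>T \<subseteq> I. independent_in M C0 C1 B T \<and>
    (\<forall>i \<in> I. independent_in M C0 C1 B (insert i T) \<longrightarrow> i \<in> T)"
proof -
  let ?A = "{T. T \<subseteq> I \<and> independent_in M C0 C1 B T}"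
  have "{} \<in> ?A" using assms by (auto simp: independent_in_def)
  then have "?A \<noteq> {}" by blast
  then have "\<exists>T\<in>?A. \<forall>X\<in>?A. T \<subseteq> X \<longrightarrow> X = T"
  proof (rule subset_Zorn_nonempty)
    fix c assume c: "c \<noteq> {}" "subset.chain ?A c"
    have "independent_in M C0 C1 B (\<Union>c)"
      unfolding independent_in_def
    proof (intro allI impI)
      fix F0 F1 assume F: "finite F0" "finite F1" "F0 \<union> F1 \<subseteq> \<Union>c" "F0 \<inter> F1 = {}"
      obtain T where T: "T \<in> c" "F0 \<union> F1 \<subseteq> T"
        by (rule finite_subset_Union_chain[OF _ F(3) c]) (use F in simp)
      then have "independent_in M C0 C1 B T"
        using c(2) unfolding subset_chain_def by (simp add: subset_iff)
      then show "measure M (B \<inter> (\<Inter>i\<in>F0. C0 i) \<inter> (\<Inter>i\<in>F1. C1 i)) > 0"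
        using F(1,2) T(2) F(4) by (rule independent_inD)
    qed
    moreover have "\<Union>c \<subseteq> I" using c(2) unfolding subset_chain_def by blast
    ultimately show "\<Union>c \<in> ?A" by simp
  qed
  then obtain T where T: "T \<subseteq> I" "independent_in M C0 C1 B T"
    "\<forall>X\<in>?A. T \<subseteq> X \<longrightarrow> X = T" by auto
  have "i \<in> T" if "i \<in> I" "independent_in M C0 C1 B (insert i T)" for i
  proof -
    have "insert i T = T"
      using T(3)[rule_format, of "insert i T"] T(1) that by (simp add: subset_insertI)
    then show ?thesis by blast
  qed
  then show ?thesis using T(1,2) by (intro exI[of _ T]) simp
qed

context regular_omega_closed
begin

text \<open>A subset \<open>Z\<close> of \<open>T\<close> selects \<open>C0 i\<close> for i in
  \<open>Z\<close> and \<open>C1 i\<close> for the other i. By independence these sets have the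
  finite intersection property, and compactness gives a point \<open>x Z\<close> common to all of
  them. Different \<open>Z\<close> have different points since \<open>C0 i\<close> and
  \<open>C1 i\<close> are disjoint, so \<open>X\<close> would have at least as many points as
  \<open>T\<close> has subsets.\<close>

lemma independent_small:
  assumes C: "compact_family C" "C0 ` T \<union> C1 ` T \<subseteq> C" "C \<subseteq> Pow X" "|X| =o r"
    and disj: "\<And>i. i \<in> T \<Longrightarrow> C0 i \<inter> C1 i = {}"
    and T: "independent_in M C0 C1 B T"
  shows "|T| <o r"
proof (rule ccontr)
  assume "\<not> |T| <o r"
  then have rT: "r \<le>o |T|"
    using not_ordLess_iff_ordLeq[of r "|T|"] card_of_Well_order[of T] Cinfinite
    by (simp add: card_order_on_def)
  \<comment> \<open>For empty \<open>T\<close> the family \<open>?D\<close> below would be empty,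
    and its intersection \<open>UNIV\<close> would not place the point inside
    \<open>X\<close>.\<close>
  have "T \<noteq> {}" using \<open>\<not> |T| <o r\<close> small_finite by auto
  have "\<exists>x. x \<in> X \<and> (\<forall>i\<in>Z. x \<in> C0 i) \<and> (\<forall>i\<in>T-Z. x \<in> C1 i)" if Z: "Z \<subseteq> T" for Z
  proof -
    let ?D = "C0 ` Z \<union> C1 ` (T - Z)"
    have "fip ?D"
      unfolding fip_def
    proof (intro allI impI)
      fix Q assume Q: "finite Q" "Q \<noteq> {}" "Q \<subseteq> ?D"
      obtain F0 where F0: "finite F0" "F0 \<subseteq> Z" "Q \<inter> C0 ` Z = C0 ` F0"
        using finite_subset_image[of "Q \<inter> C0 ` Z" C0 Z] Q(1) by auto
      obtain F1 where F1: "finite F1" "F1 \<subseteq> T - Z" "Q \<inter> C1 ` (T - Z) = C1 ` F1"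
        using finite_subset_image[of "Q \<inter> C1 ` (T - Z)" C1 "T - Z"] Q(1) by auto
      have "Q = (Q \<inter> C0 ` Z) \<union> (Q \<inter> C1 ` (T - Z))" using Q(3) by blast
      then have "Q = C0 ` F0 \<union> C1 ` F1" unfolding F0(3) F1(3) .
      then have "B \<inter> (\<Inter>i\<in>F0. C0 i) \<inter> (\<Inter>i\<in>F1. C1 i) \<subseteq> \<Inter>Q"
        by auto
      moreover have "measure M (B \<inter> (\<Inter>i\<in>F0. C0 i) \<inter> (\<Inter>i\<in>F1. C1 i)) > 0"
        using F0 F1 Z by (intro independent_inD[OF T]) auto
      then have "B \<inter> (\<Inter>i\<in>F0. C0 i) \<inter> (\<Inter>i\<in>F1. C1 i) \<noteq> {}"
        by (metis measure_empty less_irrefl)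
      ultimately show "\<Inter>Q \<noteq> {}" by (metis subset_empty)
    qed
    moreover have "?D \<subseteq> C" using C(2) Z by blast
    ultimately have "\<Inter>?D \<noteq> {}" using C(1) unfolding compact_family_def by blast
    then obtain x where x: "x \<in> \<Inter>?D" by blast
    have "?D \<noteq> {}" using \<open>T \<noteq> {}\<close> Z by auto
    then obtain c where "c \<in> ?D" by blast
    moreover have "c \<in> Pow X" using \<open>c \<in> ?D\<close> \<open>?D \<subseteq> C\<close> C(3) by (meson subsetD)
    ultimately have "x \<in> X" using x by auto
    then show ?thesis using x by (intro exI[of _ x]) auto
  qed
  then have "\<forall>Z. Z \<subseteq> T \<longrightarrow> (\<exists>x. x \<in> X \<and> (\<forall>i\<in>Z. x \<in> C0 i) \<and> (\<forall>i\<in>T-Z. x \<in> C1 i))"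
    by blast
  then obtain x where "\<forall>Z. Z \<subseteq> T \<longrightarrow> x Z \<in> X \<and> (\<forall>i\<in>Z. x Z \<in> C0 i) \<and> (\<forall>i\<in>T-Z. x Z \<in> C1 i)"
    unfolding choice_iff' by auto
  then have x: "\<And>Z. Z \<subseteq> T \<Longrightarrow> x Z \<in> X" "\<And>Z i. Z \<subseteq> T \<Longrightarrow> i \<in> Z \<Longrightarrow> x Z \<in> C0 i"
    "\<And>Z i. Z \<subseteq> T \<Longrightarrow> i \<in> T - Z \<Longrightarrow> x Z \<in> C1 i" by auto
  have "inj_on x (Pow T)"
  proof (rule inj_onI)
    have sub: "Z \<subseteq> Z'" if "x Z = x Z'" "Z \<subseteq> T" "Z' \<subseteq> T" for Z Z'
    proof (rule subsetI, rule ccontr)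
      fix i assume "i \<in> Z" "i \<notin> Z'"
      then have "x Z \<in> C0 i \<inter> C1 i" using that x(2)[of Z i] x(3)[of Z' i] by auto
      then show False using disj[of i] \<open>i \<in> Z\<close> that by auto
    qed
    fix Z Z' assume "Z \<in> Pow T" "Z' \<in> Pow T" "x Z = x Z'"
    then show "Z = Z'" using sub[of Z Z'] sub[of Z' Z] by auto
  qed
  moreover have "x ` Pow T \<subseteq> X" using x by auto
  ultimately have "|Pow T| \<le>o |X|" by (intro card_of_ordLeqI[of x]) auto
  then have "|Pow T| \<le>o |T|"
    by (rule ordLeq_transitive[OF _ ordIso_ordLeq_trans[OF C(4) rT]])
  then show False using card_of_Pow[of T] not_ordLess_ordLeq by auto
qed

text \<open>One step adds complements, countable unions and the families \<open>W B\<close>. Closure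
  under countable unions survives the iteration because \<open>small_closure\<close> puts every
  sequence of \<open>Z\<close> into a single stage to which \<open>step\<close> is applied.\<close>

lemma small_closed_algebra:
  fixes M :: "'a measure" and W :: "'a set \<Rightarrow> 'a set set"
  assumes W: "\<And>B. |W B| <o r"
  obtains Z where "|Z| <o r" "Z \<subseteq> sets M" "space M \<in> Z"
    "\<And>B. B \<in> Z \<Longrightarrow> space M - B \<in> Z"
    "\<And>s :: nat \<Rightarrow> 'a set. range s \<subseteq> Z \<Longrightarrow> (\<Union>n. s n) \<in> Z"
    "\<And>B. B \<in> Z \<Longrightarrow> W B \<inter> sets M \<subseteq> Z"
proof -
  define step where "step S = {space M} \<union> ((\<lambda>B. space M - B) ` S \<union>
    ((\<lambda>s. \<Union>n. s n) ` {s :: nat \<Rightarrow> 'a set. range s \<subseteq> S} \<union> (\<Union>B\<in>S. W B)))" for S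
  have un: "|A \<union> B| <o r" if "|A| <o r" "|B| <o r" for A B :: "'a set set"
  proof -
    have "|\<Union>i\<in>{True, False}. if i then A else B| <o r"
      using that by (intro small_UN) (auto simp: small_finite)
    then show ?thesis by (simp add: Un_commute)
  qed
  have "|step S| <o r" if "|S| <o r" for S
    unfolding step_def using that
    by (intro un small_image small_UN small_sequences W) (auto simp: small_finite)
  then obtain Z where Z: "|Z| <o r" "step {} \<subseteq> Z"
    "\<And>s :: nat \<Rightarrow> 'a set. range s \<subseteq> Z \<Longrightarrow> \<exists>A. range s \<subseteq> A \<and> step A \<subseteq> Z"
    using small_closure by blast
  have one: "\<exists>A. B \<in> A \<and> step A \<subseteq> Z" if "B \<in> Z" for B
    using Z(3)[of "\<lambda>_. B"] that by auto
  \<comment> \<open>The iteration may leave \<open>sets M\<close>, so only measurable members are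
    kept; the closure properties are unaffected.\<close>
  show thesis
  proof (rule that[of "Z \<inter> sets M"])
    show "|Z \<inter> sets M| <o r" by (rule small_mono[OF Z(1)]) auto
    show "space M \<in> Z \<inter> sets M" using Z(2) by (auto simp: step_def)
    show "space M - B \<in> Z \<inter> sets M" if "B \<in> Z \<inter> sets M" for B
      using one[of B] that by (auto simp: step_def)
    show "W B \<inter> sets M \<subseteq> Z \<inter> sets M" if "B \<in> Z \<inter> sets M" for B
      using one[of B] that by (auto simp: step_def)
    show "(\<Union>n. s n) \<in> Z \<inter> sets M" if s: "range s \<subseteq> Z \<inter> sets M" for s :: "nat \<Rightarrow> 'a set"
    proof -
      obtain A where "range s \<subseteq> A" "step A \<subseteq> Z" using Z(3)[of s] s by auto
      then have "(\<Union>n. s n) \<in> Z" by (auto simp: step_def)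
      then show ?thesis using s by auto
    qed
  qed auto
qed

text \<open>Some member of a large separated family is far from any small sigma-algebra \<open>Z\<close>, hence its
  approximating pair splits every positive part in \<open>Z\<close> of a fixed \<open>B \<in> Z\<close>. If \<open>Z\<close> contains the
  sets of a maximal independent family for \<open>B\<close>, the pair can be added to that family.\<close>

theorem not_compact:
  fixes M :: "'a measure" and A :: "'i \<Rightarrow> 'a set"
  assumes fin: "finite_measure M" and X: "|space M| =o r" and I: "|I| =o r"
    and A: "\<And>i. i \<in> I \<Longrightarrow> A i \<in> sets M" and "\<epsilon> > 0"
    and separated: "\<And>G. G \<in> sets M \<Longrightarrow> finite {i \<in> I. measure M (sym_diff (A i) G) < \<epsilon>}"
  shows "\<not> compact_measure_space M"
proof
  interpret finite_measure M by fact
  assume "compact_measure_space M"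
  then obtain C' where C': "C' \<subseteq> sets M" "compact_family C'" "inner_regular_family M C'"
    by (auto simp: compact_measure_space_def)
  define C where "C = insert {} C'"
  have C: "C \<subseteq> sets M" "compact_family C"
    using C' by (auto simp: C_def compact_family_insert_empty)
  \<comment> \<open>The tolerance is half of \<epsilon> because the losses for \<open>A i\<close>
    and for its complement are added below.\<close>
  have "\<exists>K \<in> C. K \<subseteq> D \<and> measure M D - \<epsilon>/2 < measure M K" if "D \<in> sets M" for D
    unfolding C_def using that C' \<open>\<epsilon> > 0\<close> by (intro inner_regular_approx fin) auto
  then obtain K where K: "\<And>D. D \<in> sets M \<Longrightarrow> K D \<in> C" "\<And>D. D \<in> sets M \<Longrightarrow> K D \<subseteq> D"
    "\<And>D. D \<in> sets M \<Longrightarrow> measure M D - \<epsilon>/2 < measure M (K D)" by metis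
  define C0 where "C0 i = K (A i)" for i
  define C1 where "C1 i = K (space M - A i)" for i
  have CC: "C0 i \<in> C" "C1 i \<in> C" "C0 i \<subseteq> A i" "C1 i \<subseteq> space M - A i" if "i \<in> I" for i
    using A[OF that] K by (auto simp: C0_def C1_def)
  then have CCs: "C0 i \<in> sets M" "C1 i \<in> sets M" if "i \<in> I" for i
    using C that by auto
  have disj: "C0 i \<inter> C1 i = {}" if "i \<in> I" for i using CC[OF that] by auto
  have "\<forall>B. measure M B > 0 \<longrightarrow> (\<exists>T. T \<subseteq> I \<and> independent_in M C0 C1 B T \<and>
      (\<forall>i \<in> I. independent_in M C0 C1 B (insert i T) \<longrightarrow> i \<in> T))"
    using maximal_independent_exists by blast
  then obtain T where "\<forall>B. measure M B > 0 \<longrightarrow> T B \<subseteq> I \<and> independent_in M C0 C1 B (T B) \<and>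
      (\<forall>i \<in> I. independent_in M C0 C1 B (insert i (T B)) \<longrightarrow> i \<in> T B)"
    unfolding choice_iff' by auto
  then have T: "\<And>B. measure M B > 0 \<Longrightarrow> T B \<subseteq> I"
    "\<And>B. measure M B > 0 \<Longrightarrow> independent_in M C0 C1 B (T B)"
    "\<And>B i. measure M B > 0 \<Longrightarrow> i \<in> I \<Longrightarrow> independent_in M C0 C1 B (insert i (T B)) \<Longrightarrow> i \<in> T B"
    by auto
  have small: "|T B| <o r" if "measure M B > 0" for B
  proof (rule independent_small[OF C(2) _ _ X _ T(2)[OF that]])
    show "C0 ` T B \<union> C1 ` T B \<subseteq> C" using CC(1,2) T(1)[OF that] by auto
    show "C \<subseteq> Pow (space M)" using C(1) sets.space_closed by (rule subset_trans)
    show "C0 i \<inter> C1 i = {}" if "i \<in> T B" for i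
      using disj T(1)[OF \<open>measure M B > 0\<close>] that by auto
  qed
  \<comment> \<open>Where \<open>measure M B\<close> is 0, \<open>T B\<close> is unspecified and
    might not be small, so nothing is added.\<close>
  define W where "W B = (if measure M B > 0 then C0 ` T B \<union> C1 ` T B else {})" for B
  have "|W B| <o r" for B
  proof (cases "measure M B > 0")
    case True
    have "|\<Union>i\<in>T B. {C0 i, C1 i}| <o r"
      using True by (intro small_UN small small_finite) auto
    moreover have "W B \<subseteq> (\<Union>i\<in>T B. {C0 i, C1 i})" by (auto simp: W_def)
    ultimately show ?thesis by (rule small_mono)
  qed (auto simp: W_def small_finite)
  then obtain Z where Z: "|Z| <o r" "Z \<subseteq> sets M" "space M \<in> Z"
    "\<And>B. B \<in> Z \<Longrightarrow> space M - B \<in> Z"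
    "\<And>s :: nat \<Rightarrow> 'a set. range s \<subseteq> Z \<Longrightarrow> (\<Union>n. s n) \<in> Z"
    "\<And>B. B \<in> Z \<Longrightarrow> W B \<inter> sets M \<subseteq> Z"
    using small_closed_algebra[of W M] by blast
  have Z_Un: "B \<union> D \<in> Z" if "B \<in> Z" "D \<in> Z" for B D
  proof -
    have "(\<Union>n::nat. if n = 0 then B else D) \<in> Z"
      using that by (intro Z(5)) auto
    moreover have "(\<Union>n::nat. if n = 0 then B else D) = B \<union> D" by (auto split: if_splits)
    ultimately show ?thesis by simp
  qed
  have Z_Diff: "B - D \<in> Z" if "B \<in> Z" "D \<in> Z" for B D
  proof -
    have "B - D = space M - ((space M - B) \<union> D)"
      using that Z(2) sets.sets_into_space by blast
    then show ?thesis using Z_Un Z(4) that by simp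
  qed
  have Z_Int: "B \<inter> D \<in> Z" if "B \<in> Z" "D \<in> Z" for B D
  proof -
    have "B \<inter> D = B - (B - D)" by blast
    then show ?thesis using Z_Diff that by simp
  qed
  \<comment> \<open>Each \<open>G\<close> in \<open>Z\<close> is close to finitely many
    \<open>A i\<close> only, so by regularity the small \<open>Z\<close> cannot account for all of
    \<open>I\<close>.\<close>
  have "\<exists>i \<in> I. \<forall>G \<in> Z. measure M (sym_diff (A i) G) \<ge> \<epsilon>"
  proof (rule ccontr)
    assume "\<not> ?thesis"
    then have "I \<subseteq> (\<Union>G\<in>Z. {i \<in> I. measure M (sym_diff (A i) G) < \<epsilon>})" by force
    moreover have "|\<Union>G\<in>Z. {i \<in> I. measure M (sym_diff (A i) G) < \<epsilon>}| <o r"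
      using Z(2) by (intro small_UN[OF Z(1)] small_finite separated) auto
    ultimately have "|I| <o r" by (rule small_mono[rotated])
    then show False using I not_ordLess_ordIso by blast
  qed
  then obtain i where i: "i \<in> I" "\<And>G. G \<in> Z \<Longrightarrow> measure M (sym_diff (A i) G) \<ge> \<epsilon>" by blast
  \<comment> \<open>Among the members of \<open>Z\<close> that meet \<open>D\<close> in a null set
    there is an essentially largest one, since they are closed under countable unions.\<close>
  have null: "\<exists>N\<in>Z. measure M (N \<inter> D) = 0 \<and> (\<forall>B\<in>Z. measure M (B \<inter> D) = 0 \<longrightarrow> measure M (B - N) = 0)"
    if D: "D \<in> sets M" for D
  proof -
    have UN: "(\<Union>n. s n) \<in> {N \<in> Z. measure M (N \<inter> D) = 0}"
      if "range s \<subseteq> {N \<in> Z. measure M (N \<inter> D) = 0}" for s :: "nat \<Rightarrow> 'a set"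
    proof -
      have s: "s n \<in> Z" "s n \<inter> D \<in> null_sets M" for n
        using that D Z(2) by (auto simp: null_sets_def emeasure_eq_measure)
      have "(\<Union>n. s n \<inter> D) \<in> null_sets M" using s(2) by (intro null_sets_UN)
      moreover have "(\<Union>n. s n \<inter> D) = (\<Union>n. s n) \<inter> D" by blast
      ultimately have "measure M ((\<Union>n. s n) \<inter> D) = 0"
        by (simp only: measure_eq_0_null_sets)
      moreover have "(\<Union>n. s n) \<in> Z" using s by (intro Z(5)) auto
      ultimately show ?thesis by simp
    qed
    have "{} \<in> {N \<in> Z. measure M (N \<inter> D) = 0}"
      using Z_Diff[OF Z(3) Z(3)] by simp
    then obtain N where "N \<in> {N \<in> Z. measure M (N \<inter> D) = 0}"
      "\<And>B. B \<in> {N \<in> Z. measure M (N \<inter> D) = 0} \<Longrightarrow> measure M (B - N) = 0"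
      using essential_maximum[of "{N \<in> Z. measure M (N \<inter> D) = 0}"] UN Z(2) by blast
    then show ?thesis by auto
  qed
  obtain N0 where N0: "N0 \<in> Z" "measure M (N0 \<inter> C0 i) = 0"
    "\<And>B. B \<in> Z \<Longrightarrow> measure M (B \<inter> C0 i) = 0 \<Longrightarrow> measure M (B - N0) = 0"
    using null[of "C0 i"] CCs i(1) by blast
  obtain N1 where N1: "N1 \<in> Z" "measure M (N1 \<inter> C1 i) = 0"
    "\<And>B. B \<in> Z \<Longrightarrow> measure M (B \<inter> C1 i) = 0 \<Longrightarrow> measure M (B - N1) = 0"
    using null[of "C1 i"] CCs i(1) by blast
  \<comment> \<open>\<open>B\<close> is what remains after removing the essentially largest members
    of \<open>Z\<close> that almost miss \<open>C0 i\<close> or \<open>C1 i\<close>. A positive part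
    of \<open>B\<close> in \<open>Z\<close> therefore meets both of these sets in positive
    measure.\<close>
  define B where "B = space M - (N0 \<union> N1)"
  have BZ: "B \<in> Z" unfolding B_def using N0 N1 Z_Un Z(4) by blast
  have splits: "measure M (D \<inter> C0 i) > 0" "measure M (D \<inter> C1 i) > 0"
    if D: "D \<in> Z" "D \<subseteq> B" "measure M D > 0" for D
  proof -
    have "D - N0 = D" "D - N1 = D" using D(2) by (auto simp: B_def)
    then show "measure M (D \<inter> C0 i) > 0" "measure M (D \<inter> C1 i) > 0"
      using N0(3)[of D] N1(3)[of D] D measure_nonneg[of M] by (metis less_le)+
  qed
  note sets = CCs[OF i(1)] A[OF i(1)] subsetD[OF Z(2) N0(1)] subsetD[OF Z(2) N1(1)]
    subsetD[OF Z(2) BZ]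
  \<comment> \<open>If \<open>B\<close> were null, \<open>N0\<close> and \<open>N1\<close> would
    cover almost all of the space. As \<open>N0\<close> almost misses \<open>C0 i\<close> and
    \<open>N1\<close> almost misses \<open>C1 i\<close>, the set \<open>N1\<close> would differ from
    \<open>A i\<close>, up to null sets, only outside \<open>C0 i \<union> C1 i\<close>, hence by
    less than \<epsilon>, although it lies in \<open>Z\<close>.\<close>
  have "measure M B > 0"
  proof (rule ccontr)
    assume "\<not> measure M B > 0"
    then have B0: "measure M B = 0" using measure_nonneg[of M B] by linarith
    let ?R = "(A i - C0 i) \<union> ((space M - A i) - C1 i)"
    have "measure M ?R \<le> measure M (A i - C0 i) + measure M ((space M - A i) - C1 i)"
      using sets by (intro measure_Un_le) auto
    also have "\<dots> < \<epsilon>"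
      using K(3)[OF sets(3)] K(3)[of "space M - A i"] sets CC[OF i(1)]
      by (simp add: finite_measure_Diff C0_def C1_def)
    finally have R: "measure M ?R < \<epsilon>" .
    have "sym_diff (A i) N1 \<subseteq> ?R \<union> ((N0 \<inter> C0 i) \<union> ((N1 \<inter> C1 i) \<union> B))"
      using sets.sets_into_space[OF sets(3)] sets.sets_into_space[OF sets(5)]
      by (auto simp: B_def)
    then have "measure M (sym_diff (A i) N1) \<le> measure M (?R \<union> ((N0 \<inter> C0 i) \<union> ((N1 \<inter> C1 i) \<union> B)))"
      using sets by (intro finite_measure_mono) auto
    also have "\<dots> \<le> measure M ?R + measure M ((N0 \<inter> C0 i) \<union> ((N1 \<inter> C1 i) \<union> B))"
      using sets by (intro measure_Un_le) auto
    also have "measure M ((N0 \<inter> C0 i) \<union> ((N1 \<inter> C1 i) \<union> B)) \<le> measure M (N0 \<inter> C0 i) + measure M ((N1 \<inter> C1 i) \<union> B)"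
      using sets by (intro measure_Un_le) auto
    also have "measure M ((N1 \<inter> C1 i) \<union> B) \<le> measure M (N1 \<inter> C1 i) + measure M B"
      using sets by (intro measure_Un_le) auto
    finally have "measure M (sym_diff (A i) N1) < \<epsilon>"
      using R N0(2) N1(2) B0 by simp
    then show False using i(2)[OF N1(1)] by simp
  qed
  note B = this
  have TZ: "C0 j \<in> Z" "C1 j \<in> Z" if "j \<in> T B" for j
    using Z(6)[OF BZ] that B CCs T(1)[OF B] by (auto simp: W_def)
  show False
  proof (cases "i \<in> T B")
    case True
    \<comment> \<open>Here \<open>C0 i\<close> itself belongs to \<open>Z\<close>, so
      \<open>splits\<close> applies to \<open>B \<inter> C0 i\<close> and yields a positive part
      inside the disjoint set \<open>C1 i\<close>.\<close>
    have "measure M (B \<inter> C0 i) > 0" using splits(1)[OF BZ] B by simp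
    then have "measure M ((B \<inter> C0 i) \<inter> C1 i) > 0"
      using splits(2)[of "B \<inter> C0 i"] Z_Int[OF BZ TZ(1)[OF True]] by simp
    then show False using disj[OF i(1)] by (simp add: Int_assoc)
  next
    case False
    have "independent_in M C0 C1 B (insert i (T B))"
      unfolding independent_in_def
    proof (intro allI impI)
      fix F0 F1 assume F: "finite F0" "finite F1" "F0 \<union> F1 \<subseteq> insert i (T B)" "F0 \<inter> F1 = {}"
      \<comment> \<open>The part of the combination without the index i lies in \<open>Z\<close> and
        is positive by independence of \<open>T B\<close>; \<open>splits\<close> then supplies the
        missing factor.\<close>
      define D where "D = B \<inter> (\<Inter>j\<in>F0 - {i}. C0 j) \<inter> (\<Inter>j\<in>F1 - {i}. C1 j)"
      have INT: "B' \<inter> (\<Inter>j\<in>F. K j) \<in> Z" if "finite F" "B' \<in> Z" "\<And>j. j \<in> F \<Longrightarrow> K j \<in> Z"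
        for F B' and K :: "'i \<Rightarrow> 'a set"
        using that
      proof (induction F arbitrary: B')
        case (insert j F)
        have "(B' \<inter> K j) \<inter> (\<Inter>j\<in>F. K j) \<in> Z"
        proof (rule insert.IH)
          show "B' \<inter> K j \<in> Z" using insert.prems by (intro Z_Int) auto
        qed (use insert.prems in auto)
        then show ?case by (simp add: Int_assoc)
      qed simp
      have DZ: "D \<in> Z"
        unfolding D_def using F by (intro INT BZ TZ) auto
      have D0: "measure M D > 0"
        unfolding D_def using F by (intro independent_inD[OF T(2)[OF B]]) auto
      have DB: "D \<subseteq> B" by (auto simp: D_def)
      note s = splits[OF DZ DB D0]
      consider "i \<in> F0" "i \<notin> F1" | "i \<in> F1" "i \<notin> F0" | "i \<notin> F0" "i \<notin> F1" using F(4) by blast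
      then show "measure M (B \<inter> (\<Inter>i\<in>F0. C0 i) \<inter> (\<Inter>i\<in>F1. C1 i)) > 0"
      proof cases
        case 1
        then have "(\<Inter>j\<in>F0. C0 j) = C0 i \<inter> (\<Inter>j\<in>F0 - {i}. C0 j)" "F1 - {i} = F1"
          using INT_insert[of C0 i "F0 - {i}"] by (simp_all add: insert_absorb)
        then have "B \<inter> (\<Inter>i\<in>F0. C0 i) \<inter> (\<Inter>i\<in>F1. C1 i) = D \<inter> C0 i"
          unfolding D_def by (simp only: Int_ac)
        then show ?thesis using s by simp
      next
        case 2
        then have "(\<Inter>j\<in>F1. C1 j) = C1 i \<inter> (\<Inter>j\<in>F1 - {i}. C1 j)" "F0 - {i} = F0"
          using INT_insert[of C1 i "F1 - {i}"] by (simp_all add: insert_absorb)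
        then have "B \<inter> (\<Inter>i\<in>F0. C0 i) \<inter> (\<Inter>i\<in>F1. C1 i) = D \<inter> C1 i"
          unfolding D_def by (simp only: Int_ac)
        then show ?thesis using s by simp
      next
        case 3
        then show ?thesis using D0 by (simp add: D_def)
      qed
    qed
    then show False using T(3)[OF B i(1)] False by blast
  qed
qed

end

section \<open>Walsh functions\<close>

text \<open>The inner product modulo 2 of the binary digit vectors of i and x: it is true where the
  Walsh function with index i takes the value -1.\<close>

definition walsh :: "nat \<Rightarrow> nat \<Rightarrow> bool" where
  "walsh i x \<longleftrightarrow> odd (card {b. bit i b \<and> bit x b})"

lemma finite_bits: "finite {b. bit (i :: nat) b}"
proof (rule finite_subset)
  show "{b. bit i b} \<subseteq> {..<i}"
  proof
    fix b assume "b \<in> {b. bit i b}"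
    then have "odd (i div 2 ^ b)" by (simp add: bit_iff_odd)
    then have "i div 2 ^ b \<noteq> 0" by (intro notI) simp
    then have "2 ^ b \<le> i" by (simp add: div_eq_0_iff)
    moreover have "b < 2 ^ b" by (rule less_exp)
    ultimately have "b < i" by (rule order.strict_trans2[rotated])
    then show "b \<in> {..<i}" by simp
  qed
qed simp

lemma walsh_flip: "walsh i (flip_bit b x) \<longleftrightarrow> (walsh i x \<noteq> bit i b)"
proof -
  let ?S = "{c. bit i c \<and> bit x c}"
  have fin: "finite ?S" by (rule finite_subset[OF _ finite_bits[of i]]) auto
  show ?thesis
  proof (cases "bit i b")
    case False
    then have "{c. bit i c \<and> bit (flip_bit b x) c} = ?S"
      by (auto simp: bit_flip_bit_iff)
    then show ?thesis using False by (simp add: walsh_def)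
  next
    case ib: True
    show ?thesis
    proof (cases "bit x b")
      case True
      then have "?S = insert b {c. bit i c \<and> bit (flip_bit b x) c}"
        using ib by (auto simp: bit_flip_bit_iff)
      moreover have "b \<notin> {c. bit i c \<and> bit (flip_bit b x) c}"
        using True by (simp add: bit_flip_bit_iff)
      ultimately have "card ?S = Suc (card {c. bit i c \<and> bit (flip_bit b x) c})"
        using fin by simp
      then show ?thesis using ib by (simp add: walsh_def)
    next
      case False
      then have "{c. bit i c \<and> bit (flip_bit b x) c} = insert b ?S"
        using ib by (auto simp: bit_flip_bit_iff)
      moreover have "b \<notin> ?S" using False by simp
      ultimately have "card {c. bit i c \<and> bit (flip_bit b x) c} = Suc (card ?S)"
        using fin by simp
      then show ?thesis using ib by (simp add: walsh_def)
    qed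
  qed
qed

lemma flip_bit_less:
  fixes x :: nat
  assumes "b < m" "x < 2 ^ m"
  shows "flip_bit b x < 2 ^ m"
proof -
  have x: "n < m" if "bit x n" for n
  proof -
    have "take_bit m x = x" using assms(2) by (simp add: take_bit_nat_eq_self_iff)
    then have "bit (take_bit m x) n" using that by simp
    then show ?thesis by (simp add: bit_take_bit_iff)
  qed
  have "take_bit m (flip_bit b x) = flip_bit b x"
    by (rule bit_eqI) (use x assms(1) in \<open>auto simp: bit_take_bit_iff bit_flip_bit_iff\<close>)
  then show ?thesis by (simp add: take_bit_nat_eq_self_iff)
qed

lemma flip_bit_flip_bit: "flip_bit b (flip_bit b (x :: nat)) = x"
  by (rule bit_eqI) (auto simp: bit_flip_bit_iff)

text \<open>Flipping a digit at which i and j differ is an involution below \<open>2 ^ m\<close>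
  that exchanges agreement and disagreement.\<close>

lemma walsh_half:
  assumes "b < m" "bit i b \<noteq> bit j b"
  shows "2 * card {x. x < 2 ^ m \<and> walsh i x \<noteq> walsh j x} = 2 ^ m"
proof -
  let ?S = "{x. x < 2 ^ m \<and> walsh i x \<noteq> walsh j x}"
  let ?T = "{x. x < 2 ^ m \<and> walsh i x = walsh j x}"
  have "bij_betw (flip_bit b) ?S ?T"
    by (rule bij_betwI[of _ _ _ "flip_bit b"])
      (use assms in \<open>auto simp: walsh_flip flip_bit_less flip_bit_flip_bit\<close>)
  then have "card ?T = card ?S" by (rule bij_betw_same_card[symmetric])
  moreover have "card {x::nat. x < 2 ^ m} = card (?S \<union> ?T)"
    by (rule arg_cong[of _ _ card]) auto
  moreover have "card (?S \<union> ?T) = card ?S + card ?T"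
    by (rule card_Un_disjoint) auto
  ultimately show ?thesis by simp
qed

text \<open>Half of the numbers below \<open>2 ^ m\<close> are disagreements, and
  \<open>2 ^ m\<close> exceeds half of n; this is the source of the factor 4.\<close>

lemma walsh_far:
  assumes "2 ^ m \<le> n" "n < 2 ^ Suc m" "b < m" "bit i b \<noteq> bit j b"
  shows "n \<le> 4 * card {x \<in> {1..n}. walsh i x \<noteq> walsh j x}"
proof -
  have "{x. x < 2 ^ m \<and> walsh i x \<noteq> walsh j x} \<subseteq> {x \<in> {1..n}. walsh i x \<noteq> walsh j x}"
  proof
    fix x assume x: "x \<in> {x. x < 2 ^ m \<and> walsh i x \<noteq> walsh j x}"
    \<comment> \<open>The block below \<open>2 ^ m\<close> contains 0, which is not in
      \<open>{1..n}\<close>, but every \<open>walsh i\<close> is false there.\<close>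
    then have "x \<noteq> 0" by (cases "x = 0") (auto simp: walsh_def)
    then show "x \<in> {x \<in> {1..n}. walsh i x \<noteq> walsh j x}" using x assms(1) by auto
  qed
  then have "card {x. x < 2 ^ m \<and> walsh i x \<noteq> walsh j x} \<le> card {x \<in> {1..n}. walsh i x \<noteq> walsh j x}"
    by (intro card_mono) auto
  then show ?thesis using walsh_half[OF assms(3,4)] assms(2) by simp
qed

text \<open>Codewords may agree only if their indices differ in the leading bit alone, so at most two
  indices share a codeword.\<close>

lemma walsh_separated:
  assumes "i \<in> {1..n}" "j \<in> {1..n}" "k \<in> {1..n}" "i \<noteq> j" "i \<noteq> k" "j \<noteq> k"
  shows "n \<le> 4 * card {x \<in> {1..n}. walsh i x \<noteq> walsh j x} \<or>
    n \<le> 4 * card {x \<in> {1..n}. walsh i x \<noteq> walsh k x}"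
proof -
  obtain m where m: "2 ^ m \<le> n" "n < 2 ^ Suc m"
    using ex_power_ivl1[of 2 n] assms(1) by auto
  have differ: "\<exists>b<m. bit p b \<noteq> bit q b" if "p mod 2 ^ m \<noteq> q mod 2 ^ m" for p q :: nat
  proof -
    have "take_bit m p \<noteq> take_bit m q" using that by (simp add: take_bit_eq_mod)
    then show ?thesis unfolding bit_eq_iff bit_take_bit_iff by auto
  qed
  have "\<not> (i mod 2 ^ m = j mod 2 ^ m \<and> i mod 2 ^ m = k mod 2 ^ m)"
  proof
    assume eq: "i mod 2 ^ m = j mod 2 ^ m \<and> i mod 2 ^ m = k mod 2 ^ m"
    define d where "d p = p div 2 ^ m" for p :: nat
    have d: "d p < 2" if "p \<in> {1..n}" for p
    proof -
      have "p < 2 * 2 ^ m" using that m(2) by simp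
      then show ?thesis unfolding d_def by (rule less_mult_imp_div_less)
    qed
    have "d i = d j \<or> d i = d k \<or> d j = d k"
      using d[OF assms(1)] d[OF assms(2)] d[OF assms(3)] by linarith
    moreover have "p = q" if "d p = d q" "p mod 2 ^ m = q mod 2 ^ m" for p q :: nat
    proof -
      have "p = d p * 2 ^ m + p mod 2 ^ m" by (simp only: d_def div_mult_mod_eq)
      also have "\<dots> = d q * 2 ^ m + q mod 2 ^ m" by (simp only: that)
      also have "\<dots> = q" by (simp only: d_def div_mult_mod_eq)
      finally show ?thesis .
    qed
    ultimately show False using eq assms(4-6) by metis
  qed
  then consider "i mod 2 ^ m \<noteq> j mod 2 ^ m" | "i mod 2 ^ m \<noteq> k mod 2 ^ m" by blast
  then show ?thesis
  proof cases
    case 1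
    then obtain b where "b < m" "bit i b \<noteq> bit j b" using differ by blast
    from walsh_far[OF m this] show ?thesis by (rule disjI1)
  next
    case 2
    then obtain b where "b < m" "bit i b \<noteq> bit k b" using differ by blast
    from walsh_far[OF m this] show ?thesis by (rule disjI2)
  qed
qed

section \<open>Pairs and formulas\<close>

text \<open>These are first-order statements, so they transfer, and the lemmas on ordered pairs
  serve both \<open>E\<close> and \<open>F\<close>.\<close>

locale pairing_structure =
  fixes R :: "'a \<Rightarrow> 'a \<Rightarrow> bool" and U :: "'a set"
  assumes extensionality: "x \<notin> U \<Longrightarrow> y \<notin> U \<Longrightarrow> ext R x = ext R y \<Longrightarrow> x = y"
    and pairing: "\<exists>z. z \<notin> U \<and> ext R z = {x, y}"
begin

lemma mkset_eqI: "x \<notin> U \<Longrightarrow> ext R x = A \<Longrightarrow> mkset R U A = x"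
  unfolding mkset_def by (rule the_equality) (auto intro: extensionality)

text \<open>This trades the description operator for a first-order condition, at the price of an
  existence hypothesis.\<close>

lemma eq_mkset_iff:
  assumes "\<exists>z. z \<notin> U \<and> ext R z = A"
  shows "x = mkset R U A \<longleftrightarrow> x \<notin> U \<and> ext R x = A"
proof -
  obtain z where "z \<notin> U" "ext R z = A" using assms by blast
  then have "mkset R U A = z" by (rule mkset_eqI)
  moreover have "x = z" if "x \<notin> U" "ext R x = A"
    using that \<open>z \<notin> U\<close> \<open>ext R z = A\<close> by (intro extensionality) auto
  ultimately show ?thesis using \<open>z \<notin> U\<close> \<open>ext R z = A\<close> by auto
qed

lemma eq_upair_iff: "x = mkset R U {y, z} \<longleftrightarrow> x \<notin> U \<and> ext R x = {y, z}"
  by (rule eq_mkset_iff[OF pairing])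

text \<open>The singleton is written as \<open>{x, x}\<close> so that one formula for unordered
  pairs serves all three sets.\<close>

lemma eq_opair_iff:
  "p = opair R U x y \<longleftrightarrow> (\<exists>s t. s = mkset R U {x, x} \<and> t = mkset R U {x, y} \<and> p = mkset R U {s, t})"
  by (simp add: opair_def)

lemma upair_eq_iff: "mkset R U {x, y} = mkset R U {x', y'} \<longleftrightarrow> {x, y} = {x', y'}"
proof
  assume "mkset R U {x, y} = mkset R U {x', y'}"
  then show "{x, y} = {x', y'}"
    using eq_upair_iff[of "mkset R U {x, y}" x y] eq_upair_iff[of "mkset R U {x, y}" x' y'] by simp
qed simp

lemma opair_eq_iff: "opair R U x y = opair R U x' y' \<longleftrightarrow> x = x' \<and> y = y'"
proof
  assume "opair R U x y = opair R U x' y'"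
  then have *: "{mkset R U {x, x}, mkset R U {x, y}} = {mkset R U {x', x'}, mkset R U {x', y'}}"
    by (simp add: opair_def upair_eq_iff)
  then have "x = x'"
    unfolding doubleton_eq_iff upair_eq_iff by auto
  with * show "x = x' \<and> y = y'"
    unfolding doubleton_eq_iff upair_eq_iff by auto
qed simp

end

definition Forall :: "nat \<Rightarrow> fm \<Rightarrow> fm" where "Forall i f = Neg (Ex i (Neg f))"
definition Disj :: "fm \<Rightarrow> fm \<Rightarrow> fm" where "Disj f g = Neg (Conj (Neg f) (Neg g))"
definition Imp :: "fm \<Rightarrow> fm \<Rightarrow> fm" where "Imp f g = Neg (Conj f (Neg g))"
definition Iff :: "fm \<Rightarrow> fm \<Rightarrow> fm" where "Iff f g = Conj (Imp f g) (Imp g f)"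

lemma sat_connectives [simp]:
  "sat R (Forall i f) v \<longleftrightarrow> (\<forall>x. sat R f (v(i := x)))"
  "sat R (Disj f g) v \<longleftrightarrow> sat R f v \<or> sat R g v"
  "sat R (Imp f g) v \<longleftrightarrow> (sat R f v \<longrightarrow> sat R g v)"
  "sat R (Iff f g) v \<longleftrightarrow> (sat R f v \<longleftrightarrow> sat R g v)"
  by (auto simp: Forall_def Disj_def Imp_def Iff_def)

text \<open>Variable 0 is meant to hold the set of urelements. Each abbreviation binds smaller
  variables than those it is built from, so that no argument is captured.\<close>

definition Upair :: "nat \<Rightarrow> nat \<Rightarrow> nat \<Rightarrow> fm" where
  "Upair z x y = Conj (Neg (Mem z 0)) (Forall 90 (Iff (Mem 90 z) (Disj (Eq 90 x) (Eq 90 y))))"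

definition Opair :: "nat \<Rightarrow> nat \<Rightarrow> nat \<Rightarrow> fm" where
  "Opair p x y = Ex 80 (Ex 81 (Conj (Upair 80 x x) (Conj (Upair 81 x y) (Upair p 80 81))))"

definition Holds :: "nat \<Rightarrow> nat \<Rightarrow> nat \<Rightarrow> fm" where
  "Holds r x y = Ex 70 (Conj (Opair 70 x y) (Mem 70 r))"

context pairing_structure
begin

lemma sat_Upair:
  assumes "ext R (v 0) = U" "z \<noteq> 90" "x \<noteq> 90" "y \<noteq> 90"
  shows "sat R (Upair z x y) v \<longleftrightarrow> v z = mkset R U {v x, v y}"
proof -
  have "R a (v 0) \<longleftrightarrow> a \<in> U" for a using assms(1) by (auto simp: ext_def)
  then show ?thesis
    using assms(2-4) by (auto simp: Upair_def eq_upair_iff ext_def)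
qed

lemma sat_Opair:
  assumes "ext R (v 0) = U" "p < 80" "x < 80" "y < 80"
  shows "sat R (Opair p x y) v \<longleftrightarrow> v p = opair R U (v x) (v y)"
  using assms by (simp add: Opair_def sat_Upair eq_opair_iff)

lemma sat_Holds:
  assumes "ext R (v 0) = U" "r < 70" "x < 70" "y < 70"
  shows "sat R (Holds r x y) v \<longleftrightarrow> holds R U (v r) (v x) (v y)"
  using assms by (simp add: Holds_def sat_Opair holds_def)

end

section \<open>The standard universe and the relations coded in it\<close>

context standard_universe
begin

lemma level_mono: "m \<le> n \<Longrightarrow> level E \<nu> m \<subseteq> level E \<nu> n"
  by (rule lift_Suc_mono_le) auto

lemma nu_level: "\<nu> m \<in> level E \<nu> n"
  using level_mono[of 0 n] by auto

lemma vset: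
  assumes "A \<subseteq> level E \<nu> n"
  shows "vset A \<notin> range \<nu>" "ext E (vset A) = A"
proof -
  obtain x where x: "x \<notin> range \<nu>" "ext E x = A" using full[OF assms] by blast
  then have "vset A = x" unfolding mkset_def
    by (intro the_equality) (auto intro: extensional)
  then show "vset A \<notin> range \<nu>" "ext E (vset A) = A" using x by auto
qed

lemma vset_level: "A \<subseteq> level E \<nu> n \<Longrightarrow> vset A \<in> level E \<nu> (Suc n)"
  using vset[of A n] by simp

lemma common_level: "\<exists>n. x \<in> level E \<nu> n \<and> y \<in> level E \<nu> n"
proof -
  obtain m n where "x \<in> level E \<nu> m" "y \<in> level E \<nu> n" using exhaustive by blast
  then show ?thesis
    using level_mono[of m "max m n"] level_mono[of n "max m n"] by auto
qed

sublocale pairing_structure E "range \<nu>"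
proof
  fix x y
  show "x \<notin> range \<nu> \<Longrightarrow> y \<notin> range \<nu> \<Longrightarrow> ext E x = ext E y \<Longrightarrow> x = y" by (rule extensional)
  obtain n where "{x, y} \<subseteq> level E \<nu> n" using common_level[of x y] by auto
  then show "\<exists>z. z \<notin> range \<nu> \<and> ext E z = {x, y}" by (rule full)
qed

lemma vpair_level:
  assumes "x \<in> level E \<nu> n" "y \<in> level E \<nu> n"
  shows "vpair x y \<in> level E \<nu> (Suc (Suc n))"
  unfolding opair_def using assms by (intro vset_level insert_subsetI empty_subsetI) auto

lemma vset_eqI: "a \<notin> range \<nu> \<Longrightarrow> ext E a = A \<Longrightarrow> a = vset A"
  by (rule mkset_eqI[symmetric])

lemma vset_nu:
  shows "vset (\<nu> ` S) \<notin> range \<nu>" "ext E (vset (\<nu> ` S)) = \<nu> ` S" "vset (\<nu> ` S) \<in> level E \<nu> (Suc 0)"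
  using vset[of "\<nu> ` S" 0] vset_level[of "\<nu> ` S" 0] by auto

lemma vset_nu_eq_iff: "vset (\<nu> ` S) = vset (\<nu> ` T) \<longleftrightarrow> S = T"
  using vset_nu(2) inj_image_eq_iff[OF inj_nu] by metis

lemma nu_eq_iff: "\<nu> m = \<nu> n \<longleftrightarrow> m = n"
  using inj_nu by (simp add: inj_eq)

lemma ext_vnat: "ext E vnat = range \<nu>"
  unfolding vnat_def using vset(2)[of "range \<nu>" 0] by simp

lemma ext_vlevel: "ext E (vlevel n) = level E \<nu> n"
  unfolding vlevel_def by (rule vset(2)[OF subset_refl])

lemma holds_vset: "A \<subseteq> level E \<nu> n \<Longrightarrow> holds E (range \<nu>) (vset A) x y \<longleftrightarrow> vpair x y \<in> A"
  using vset(2)[of A n] by (auto simp: holds_def ext_def)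

lemma vreal_alt: "vreal x = vset (\<nu> ` to_nat ` {q :: rat. of_rat q < x})"
  unfolding vreal_def by (intro arg_cong[of _ _ vset]) auto

lemma vreal_level: "vreal x \<in> level E \<nu> (Suc 0)"
  unfolding vreal_alt by (rule vset_nu)

lemma vreal_eq_iff: "vreal x = vreal y \<longleftrightarrow> x = y"
proof
  assume "vreal x = vreal y"
  then have *: "{q :: rat. of_rat q < x} = {q. of_rat q < y}"
    unfolding vreal_alt vset_nu_eq_iff by (simp add: inj_image_eq_iff)
  show "x = y"
  proof (rule ccontr)
    assume "x \<noteq> y"
    then have "min x y < max x y" by auto
    from of_rat_dense[OF this] obtain q :: rat where "min x y < of_rat q" "of_rat q < max x y"
      by blast
    then have "(of_rat q < x) \<noteq> (of_rat q < y)" by linarith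
    then show False using * by auto
  qed
qed simp

text \<open>A bound on the rank of the components bounds the rank of the pairs, so by
  \<open>full\<close> the graph exists as an element and its \<open>vset\<close> has the intended
  members.\<close>

lemma holds_relation:
  assumes A: "A = {vpair x y | x y. P x y}"
    and level: "\<And>x y. P x y \<Longrightarrow> x \<in> level E \<nu> n \<and> y \<in> level E \<nu> n"
  shows "holds E (range \<nu>) (vset A) x y \<longleftrightarrow> P x y"
proof -
  have "A \<subseteq> level E \<nu> (Suc (Suc n))"
  proof
    fix p assume "p \<in> A"
    then obtain x y where "p = vpair x y" "P x y" unfolding A by blast
    then show "p \<in> level E \<nu> (Suc (Suc n))" using vpair_level level by simp
  qed
  then have "holds E (range \<nu>) (vset A) x y \<longleftrightarrow> vpair x y \<in> A" by (rule holds_vset)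
  also have "\<dots> \<longleftrightarrow> P x y" unfolding A by (simp add: opair_eq_iff)
  finally show ?thesis .
qed

lemma holds_vnat_le: "holds E (range \<nu>) vnat_le x y \<longleftrightarrow> (\<exists>m n. x = \<nu> m \<and> y = \<nu> n \<and> m \<le> n)"
  unfolding vnat_le_def
proof (rule holds_relation[where n = 0])
  show "{vpair (\<nu> m) (\<nu> n) |m n. m \<le> n} =
    {vpair x y |x y. \<exists>m n. x = \<nu> m \<and> y = \<nu> n \<and> m \<le> n}" by blast
qed (auto simp: nu_level)

lemma holds_vcard:
  "holds E (range \<nu>) vcard x y \<longleftrightarrow> (\<exists>S. finite S \<and> x = vset (\<nu> ` S) \<and> y = \<nu> (card S))"
  unfolding vcard_def
proof (rule holds_relation[where n = "Suc 0"])
  show "{vpair (vset (\<nu> ` S)) (\<nu> (card S)) |S. finite S} =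
    {vpair x y |x y. \<exists>S. finite S \<and> x = vset (\<nu> ` S) \<and> y = \<nu> (card S)}" by blast
qed (use vset_nu(3) nu_level in blast)

lemma holds_vreal_less: "holds E (range \<nu>) vreal_less x y \<longleftrightarrow> (\<exists>s t. x = vreal s \<and> y = vreal t \<and> s < t)"
  unfolding vreal_less_def
proof (rule holds_relation[where n = "Suc 0"])
  show "{vpair (vreal r) (vreal s) |r s. r < s} =
    {vpair x y |x y. \<exists>s t. x = vreal s \<and> y = vreal t \<and> s < t}" by blast
qed (use vreal_level in blast)

lemma holds_vquotient:
  "holds E (range \<nu>) vquotient x y \<longleftrightarrow>
    (\<exists>m n. n > 0 \<and> x = vpair (\<nu> m) (\<nu> n) \<and> y = vreal (real m / real n))"
  unfolding vquotient_def
proof (rule holds_relation[where n = "Suc (Suc 0)"])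
  show "{vpair (vpair (\<nu> m) (\<nu> n)) (vreal (real m / real n)) |m n. n > 0} =
    {vpair x y |x y. \<exists>m n. n > 0 \<and> x = vpair (\<nu> m) (\<nu> n) \<and> y = vreal (real m / real n)}"
    by blast
  have "vpair (\<nu> m) (\<nu> n) \<in> level E \<nu> (Suc (Suc 0))" for m n
    by (rule vpair_level[OF nu_level nu_level])
  moreover have "vreal x \<in> level E \<nu> (Suc (Suc 0))" for x
    using vreal_level level_mono[of "Suc 0" "Suc (Suc 0)"] by blast
  ultimately show "\<And>x y. \<exists>m n. n > 0 \<and> x = vpair (\<nu> m) (\<nu> n) \<and> y = vreal (real m / real n) \<Longrightarrow>
    x \<in> level E \<nu> (Suc (Suc 0)) \<and> y \<in> level E \<nu> (Suc (Suc 0))" by blast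
qed

text \<open>The Walsh functions become an element of the universe, so that statements about them can
  be transferred.\<close>

definition vwalsh :: 'v where
  "vwalsh = vset {vpair (\<nu> i) (\<nu> x) | i x. walsh i x}"

lemma holds_vwalsh: "holds E (range \<nu>) vwalsh x y \<longleftrightarrow> (\<exists>i k. x = \<nu> i \<and> y = \<nu> k \<and> walsh i k)"
  unfolding vwalsh_def
proof (rule holds_relation[where n = 0])
  show "{vpair (\<nu> i) (\<nu> x) |i x. walsh i x} =
    {vpair x y |x y. \<exists>i k. x = \<nu> i \<and> y = \<nu> k \<and> walsh i k}" by blast
qed (auto simp: nu_level)

end

section \<open>The parameters of the transferred formulas\<close>

text \<open>With \<open>P s\<close> for s < x and \<open>Q t\<close> for x < t, this produces the
  standard part of a hyperreal x between a and b. It is the supremum of the s with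
  \<open>P s\<close>.\<close>

lemma real_cut:
  fixes P Q :: "real \<Rightarrow> bool"
  assumes total: "\<And>s t. s < t \<Longrightarrow> P s \<or> Q t" and consistent: "\<And>s t. P s \<Longrightarrow> Q t \<Longrightarrow> s < t"
    and ends: "P a" "Q b"
  shows "\<exists>!r. \<forall>e>0. P (r - e) \<and> Q (r + e)"
proof -
  have down: "P s'" if "P s" "s' < s" for s s'
  proof -
    have "\<not> Q s" using consistent[OF that(1), of s] by (metis less_irrefl)
    then show ?thesis using total[OF that(2)] by simp
  qed
  have bdd: "bdd_above {s. P s}"
  proof (rule bdd_aboveI)
    fix s assume "s \<in> {s. P s}"
    then have "P s" by simp
    then have "s < b" using ends(2) by (rule consistent)
    then show "s \<le> b" by simp
  qed
  have upper: "s \<le> Sup {s. P s}" if "P s" for s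
    using bdd that by (intro cSup_upper) auto
  have lower: "\<forall>e>0. P (Sup {s. P s} - e) \<and> Q (Sup {s. P s} + e)"
  proof (intro allI impI conjI)
    fix e :: real assume "e > 0"
    have "\<exists>s\<in>{s. P s}. Sup {s. P s} - e < s"
      using \<open>e > 0\<close> ends(1) by (intro less_cSupD) auto
    then obtain s where "P s" "Sup {s. P s} - e < s" by blast
    then show "P (Sup {s. P s} - e)" by (rule down)
    have "\<not> P (Sup {s. P s} + e / 2)"
      using upper[of "Sup {s. P s} + e / 2"] \<open>e > 0\<close> by auto
    then show "Q (Sup {s. P s} + e)"
      using total[of "Sup {s. P s} + e / 2" "Sup {s. P s} + e"] \<open>e > 0\<close> by auto
  qed
  have less: "\<not> r < r'"
    if "\<forall>e>0. P (r - e) \<and> Q (r + e)" "\<forall>e>0. P (r' - e) \<and> Q (r' + e)" for r r'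
  proof
    assume "r < r'"
    then have "(r' - r) / 2 > 0" by simp
    then have "P (r' - (r' - r) / 2)" "Q (r + (r' - r) / 2)" using that by blast+
    then have "r' - (r' - r) / 2 < r + (r' - r) / 2" by (rule consistent)
    then show False by (simp add: field_simps)
  qed
  show ?thesis
  proof (rule ex1I)
    show "\<forall>e>0. P (Sup {s. P s} - e) \<and> Q (Sup {s. P s} + e)" by (rule lower)
    fix r assume r: "\<forall>e>0. P (r - e) \<and> Q (r + e)"
    show "r = Sup {s. P s}" using less[OF lower r] less[OF r lower] by linarith
  qed
qed

text \<open>The parameters sit in fixed variables: 0 and 2 for the natural numbers and their order,
  3 for cardinality, 4 for quotients, 5 for the order of the reals, 7 for the number 1.\<close>

definition Interval :: "nat \<Rightarrow> nat \<Rightarrow> fm" where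
  "Interval n x = Conj (Mem x 0) (Conj (Holds 2 7 x) (Holds 2 x n))"

definition Subset :: "nat \<Rightarrow> nat \<Rightarrow> fm" where
  "Subset a n = Conj (Mem n 0) (Conj (Neg (Mem a 0)) (Forall 60 (Imp (Mem 60 a) (Interval n 60))))"

definition Prob :: "nat \<Rightarrow> nat \<Rightarrow> nat \<Rightarrow> fm" where
  "Prob a n y = Ex 61 (Ex 62 (Conj (Holds 3 a 61) (Conj (Opair 62 61 n) (Holds 4 62 y))))"

definition Less :: "nat \<Rightarrow> nat \<Rightarrow> fm" where
  "Less x y = Holds 5 x y"

context standard_universe
begin

text \<open>Variables \<open>0\<close> and \<open>2\<close> to \<open>11\<close> hold the parameters of the formulas below, the variables
  from \<open>60\<close> on are bound inside the abbreviations, and the others are free for use.\<close>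

definition parameters :: "real \<Rightarrow> real \<Rightarrow> nat \<Rightarrow> 'v" where
  "parameters s t = (\<lambda>_. vnat)(2 := vnat_le, 3 := vcard, 4 := vquotient, 5 := vreal_less,
     6 := vwalsh, 7 := \<nu> 1, 8 := vreal s, 9 := vreal t, 10 := vreal (s + t), 11 := vlevel 1)"

text \<open>Only the entries 0 and 2 to 7 are fixed, a condition that survives when a quantifier
  assigns a value to a variable above 11.\<close>

definition extends_parameters :: "(nat \<Rightarrow> 'v) \<Rightarrow> bool" where
  "extends_parameters v \<longleftrightarrow> v 0 = vnat \<and> v 2 = vnat_le \<and> v 3 = vcard \<and> v 4 = vquotient \<and>
     v 5 = vreal_less \<and> v 6 = vwalsh \<and> v 7 = \<nu> 1"

lemma parameters_simps [simp]:
  "parameters s t 8 = vreal s" "parameters s t 9 = vreal t" "parameters s t 10 = vreal (s + t)"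
  "parameters s t 11 = vlevel 1" "parameters s t 0 = vnat" "parameters s t 6 = vwalsh"
  by (simp_all add: parameters_def)

lemma extends_parameters_simps [simp]:
  "extends_parameters (parameters s t)"
  "i > 11 \<Longrightarrow> extends_parameters (v(i := x)) \<longleftrightarrow> extends_parameters v"
  by (simp_all add: extends_parameters_def parameters_def)

lemma extends_parametersD:
  assumes "extends_parameters v"
  shows "ext E (v 0) = range \<nu>" "v 0 = vnat" "v 2 = vnat_le" "v 3 = vcard" "v 4 = vquotient"
    "v 5 = vreal_less" "v 6 = vwalsh" "v 7 = \<nu> 1"
  using assms by (simp_all add: extends_parameters_def ext_vnat)

lemma mem_vnat: "E x vnat \<longleftrightarrow> x \<in> range \<nu>"
  using ext_vnat by (auto simp: ext_def)

lemma mem_vset_nu: "E x (vset (\<nu> ` S)) \<longleftrightarrow> x \<in> \<nu> ` S"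
  using vset_nu(2)[of S] by (auto simp: ext_def)

lemma sat_Interval:
  assumes "extends_parameters v" "n < 70" "x < 70"
  shows "sat E (Interval n x) v \<longleftrightarrow> (\<exists>k m. v x = \<nu> k \<and> v n = \<nu> m \<and> 1 \<le> k \<and> k \<le> m)"
  using assms extends_parametersD[OF assms(1)]
  by (auto simp: Interval_def sat_Holds holds_vnat_le mem_vnat nu_eq_iff)

lemma subset_vset: 
  "a \<notin> range \<nu> \<Longrightarrow> ext E a \<subseteq> \<nu> ` T \<Longrightarrow> \<exists>S\<subseteq>T. a = vset (\<nu> ` S)"
  by (auto simp: subset_image_iff intro: vset_eqI)

lemma sat_Subset:
  assumes v: "extends_parameters v" and "n < 60" "a < 60"
  shows "sat E (Subset a n) v \<longleftrightarrow> (\<exists>S m. v n = \<nu> m \<and> v a = vset (\<nu> ` S) \<and> S \<subseteq> {1..m})"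
proof -
  have "sat E (Subset a n) v \<longleftrightarrow> (\<exists>m. v n = \<nu> m \<and> v a \<notin> range \<nu> \<and> ext E (v a) \<subseteq> \<nu> ` {1..m})"
  proof -
    have *: "(\<exists>k m'. x = \<nu> k \<and> \<nu> m = \<nu> m' \<and> 1 \<le> k \<and> k \<le> m') \<longleftrightarrow> x \<in> \<nu> ` {1..m}" for x m
      by (auto simp: nu_eq_iff)
    have "sat E (Subset a n) v \<longleftrightarrow> (\<exists>m. v n = \<nu> m) \<and> v a \<notin> range \<nu> \<and>
        (\<forall>x. E x (v a) \<longrightarrow> (\<exists>k m. x = \<nu> k \<and> v n = \<nu> m \<and> 1 \<le> k \<and> k \<le> m))"
      using assms extends_parametersD[OF v]
      by (simp add: Subset_def sat_Interval mem_vnat image_iff)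
    also have "\<dots> \<longleftrightarrow> (\<exists>m. v n = \<nu> m \<and> v a \<notin> range \<nu> \<and> ext E (v a) \<subseteq> \<nu> ` {1..m})"
    proof (cases "\<exists>m. v n = \<nu> m")
      case True
      then obtain m where "v n = \<nu> m" by blast
      then show ?thesis unfolding ext_def subset_iff mem_Collect_eq *[symmetric] by auto
    qed auto
    finally show ?thesis .
  qed
  also have "\<dots> \<longleftrightarrow> (\<exists>S m. v n = \<nu> m \<and> v a = vset (\<nu> ` S) \<and> S \<subseteq> {1..m})"
  proof
    assume "\<exists>m. v n = \<nu> m \<and> v a \<notin> range \<nu> \<and> ext E (v a) \<subseteq> \<nu> ` {1..m}"
    then obtain m where m: "v n = \<nu> m" "v a \<notin> range \<nu>" "ext E (v a) \<subseteq> \<nu> ` {1..m}" by blast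
    obtain S where "S \<subseteq> {1..m}" "v a = vset (\<nu> ` S)" using subset_vset[OF m(2,3)] by blast
    with m(1) show "\<exists>S m. v n = \<nu> m \<and> v a = vset (\<nu> ` S) \<and> S \<subseteq> {1..m}" by blast
  next
    assume "\<exists>S m. v n = \<nu> m \<and> v a = vset (\<nu> ` S) \<and> S \<subseteq> {1..m}"
    then obtain S m where "v n = \<nu> m" "v a = vset (\<nu> ` S)" "S \<subseteq> {1..m}" by blast
    then show "\<exists>m. v n = \<nu> m \<and> v a \<notin> range \<nu> \<and> ext E (v a) \<subseteq> \<nu> ` {1..m}"
      using vset_nu(1,2)[of S] image_mono[of S "{1..m}" \<nu>] by (intro exI[of _ m]) metis
  qed
  finally show ?thesis .
qed

lemma sat_Prob:
  assumes v: "extends_parameters v" and "a < 60" "n < 60" "y < 60"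
  shows "sat E (Prob a n y) v \<longleftrightarrow> (\<exists>S m. finite S \<and> m > 0 \<and> v a = vset (\<nu> ` S) \<and>
    v n = \<nu> m \<and> v y = vreal (real (card S) / real m))"
proof -
  have "sat E (Prob a n y) v \<longleftrightarrow> (\<exists>k. holds E (range \<nu>) vcard (v a) k \<and>
      holds E (range \<nu>) vquotient (vpair k (v n)) (v y))"
    using assms(2-4) extends_parametersD[OF v] by (simp add: Prob_def sat_Holds sat_Opair)
  also have "\<dots> \<longleftrightarrow> (\<exists>S m. finite S \<and> m > 0 \<and> v a = vset (\<nu> ` S) \<and>
    v n = \<nu> m \<and> v y = vreal (real (card S) / real m))" (is "?L \<longleftrightarrow> ?R")
  proof
    assume ?L
    then obtain S l m where "finite S" "v a = vset (\<nu> ` S)" "m > 0" "\<nu> (card S) = \<nu> l"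
      "v n = \<nu> m" "v y = vreal (real l / real m)"
      unfolding holds_vcard holds_vquotient opair_eq_iff by metis
    then show ?R by (intro exI[of _ S] exI[of _ m]) (simp add: nu_eq_iff)
  next
    assume ?R
    then obtain S m where "finite S" "m > 0" "v a = vset (\<nu> ` S)"
      "v n = \<nu> m" "v y = vreal (real (card S) / real m)" by blast
    then show ?L
      unfolding holds_vcard holds_vquotient opair_eq_iff
      by (intro exI[of _ "\<nu> (card S)"] conjI exI[of _ S] exI[of _ "card S"] exI[of _ m]) auto
  qed
  finally show ?thesis .
qed

lemma sat_Less:
  assumes "extends_parameters v" "x < 70" "y < 70"
  shows "sat E (Less x y) v \<longleftrightarrow> (\<exists>s t. v x = vreal s \<and> v y = vreal t \<and> s < t)"
  using assms(2,3) extends_parametersD[OF assms(1)]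
  by (simp add: Less_def sat_Holds holds_vreal_less)

end

section \<open>Transfer\<close>

context elementary_extension
begin

lemma vset_nu_vlevel: "E (vset (\<nu> ` S)) (vlevel (Suc 0))"
  using vset_nu(3)[of S] ext_vlevel[of "Suc 0"] unfolding ext_def by blast

lemma transfer: "sat E f v \<Longrightarrow> sat F f (star \<circ> v)"
  using elementary by (simp add: elementary_embedding_def)

lemma mem_hypernats: "F x (star vnat) \<longleftrightarrow> x \<in> hypernats"
  by (simp add: hypernats_def ext_def)

lemma ext_star_vnat: "ext F (star vnat) = hypernats"
  by (simp add: hypernats_def)

text \<open>Extensionality and pairing are transferred with \<open>vnat\<close> as the only
  parameter, as membership in it singles out the urelements on both sides.\<close>

sublocale hyper: pairing_structure F hypernats
proof
  fix x y
  have "sat E (Forall 12 (Forall 13 (Imp (Neg (Mem 12 0)) (Imp (Neg (Mem 13 0))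
      (Imp (Forall 14 (Iff (Mem 14 12) (Mem 14 13))) (Eq 12 13)))))) (\<lambda>_. vnat)"
  proof -
    have "\<forall>x y. x \<notin> range \<nu> \<longrightarrow> y \<notin> range \<nu> \<longrightarrow> (\<forall>z. E z x \<longleftrightarrow> E z y) \<longrightarrow> x = y"
      using extensional by (simp add: ext_def)
    then show ?thesis by (simp add: mem_vnat)
  qed
  from transfer[OF this]
  have "\<forall>x y. x \<notin> hypernats \<longrightarrow> y \<notin> hypernats \<longrightarrow> (\<forall>z. F z x \<longleftrightarrow> F z y) \<longrightarrow> x = y"
    by (simp add: mem_hypernats)
  then show "x \<notin> hypernats \<Longrightarrow> y \<notin> hypernats \<Longrightarrow> ext F x = ext F y \<Longrightarrow> x = y"
    by (simp add: ext_def set_eq_iff)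
  have "sat E (Forall 12 (Forall 13 (Ex 14 (Conj (Neg (Mem 14 0))
      (Forall 15 (Iff (Mem 15 14) (Disj (Eq 15 12) (Eq 15 13)))))))) (\<lambda>_. vnat)"
  proof -
    have "\<forall>x y. \<exists>z. z \<notin> range \<nu> \<and> (\<forall>u. E u z \<longleftrightarrow> u = x \<or> u = y)"
      using pairing by (simp add: ext_def set_eq_iff)
    then show ?thesis by (simp add: mem_vnat)
  qed
  from transfer[OF this]
  have "\<forall>x y. \<exists>z. z \<notin> hypernats \<and> (\<forall>u. F u z \<longleftrightarrow> u = x \<or> u = y)"
    by (simp add: mem_hypernats)
  then show "\<exists>z. z \<notin> hypernats \<and> ext F z = {x, y}"
    by (simp add: ext_def set_eq_iff)
qed

definition hparameters :: "real \<Rightarrow> real \<Rightarrow> nat \<Rightarrow> 'w" where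
  "hparameters s t = star \<circ> parameters s t"

definition extends_hparameters :: "(nat \<Rightarrow> 'w) \<Rightarrow> bool" where
  "extends_hparameters v \<longleftrightarrow> v 0 = star vnat \<and> v 2 = star vnat_le \<and> v 3 = star vcard \<and>
     v 4 = star vquotient \<and> v 5 = star vreal_less \<and> v 6 = star vwalsh \<and> v 7 = star (\<nu> 1)"

lemma hparameters_simps [simp]:
  "hparameters s t 8 = star (vreal s)" "hparameters s t 9 = star (vreal t)"
  "hparameters s t 10 = star (vreal (s + t))" "hparameters s t 11 = star (vlevel 1)"
  "hparameters s t 0 = star vnat" "hparameters s t 6 = star vwalsh"
  by (simp_all add: hparameters_def)

lemma extends_hparameters_simps [simp]:
  "extends_hparameters (hparameters s t)"
  "i > 11 \<Longrightarrow> extends_hparameters (v(i := x)) \<longleftrightarrow> extends_hparameters v"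
  by (simp_all add: extends_hparameters_def hparameters_def parameters_def)

lemma extends_hparametersD:
  assumes "extends_hparameters v"
  shows "ext F (v 0) = hypernats" "v 0 = star vnat" "v 2 = star vnat_le" "v 3 = star vcard"
    "v 4 = star vquotient" "v 5 = star vreal_less" "v 6 = star vwalsh" "v 7 = star (\<nu> 1)"
  using assms by (simp_all add: extends_hparameters_def hypernats_def)

lemma transfer_parameters: "sat E f (parameters s t) \<Longrightarrow> sat F f (hparameters s t)"
  unfolding hparameters_def by (rule transfer)

end

section \<open>Internal subsets of a hyperfinite set and their probabilities\<close>

context nonstandard_universe
begin

lemma sat_hInterval:
  assumes "extends_hparameters v" "n < 70" "x < 70"
  shows "sat F (Interval n x) v \<longleftrightarrow> v x \<in> hyperfinite (v n)"
  using assms(2,3) extends_hparametersD[OF assms(1)]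
  by (simp add: Interval_def hyper.sat_Holds hyperfinite_def star_le_def mem_hypernats)

lemma sat_hSubset:
  assumes "extends_hparameters v" "n < 60" "a < 60"
  shows "sat F (Subset a n) v \<longleftrightarrow>
    v n \<in> hypernats \<and> v a \<notin> hypernats \<and> ext F (v a) \<subseteq> hyperfinite (v n)"
  using assms extends_hparametersD[OF assms(1)]
  by (simp add: Subset_def sat_hInterval mem_hypernats subset_iff ext_def)

text \<open>A relation, because transferred formulas contain no description operator;
  \<open>prob_unique\<close> connects it with \<open>internal_prob\<close>.\<close>

definition is_prob :: "'w \<Rightarrow> 'w \<Rightarrow> 'w \<Rightarrow> bool" where
  "is_prob a n y \<longleftrightarrow> (\<exists>k. holds F hypernats (star vcard) a k \<and>
     holds F hypernats (star vquotient) (wpair k n) y)"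

lemma sat_hProb:
  assumes "extends_hparameters v" "a < 60" "n < 60" "y < 60"
  shows "sat F (Prob a n y) v \<longleftrightarrow> is_prob (v a) (v n) (v y)"
  using assms(2-4) extends_hparametersD[OF assms(1)]
  by (simp add: Prob_def is_prob_def hyper.sat_Holds hyper.sat_Opair)

lemma sat_hLess:
  assumes "extends_hparameters v" "x < 70" "y < 70"
  shows "sat F (Less x y) v \<longleftrightarrow> star_less (v x) (v y)"
  using assms(2,3) extends_hparametersD[OF assms(1)]
  by (simp add: Less_def hyper.sat_Holds star_less_def)

text \<open>Membership in \<open>star (vlevel 1)\<close> places the set in the truncated universe,
  as \<open>internal\<close> requires.\<close>

lemma hyperfinite_set:
  assumes "n \<in> hypernats"
  shows "\<exists>a. F a (star (vlevel 1)) \<and> a \<notin> hypernats \<and> ext F a = hyperfinite n"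
proof -
  have "sat E (Forall 12 (Imp (Mem 12 0) (Ex 13 (Conj (Mem 13 11) (Conj (Neg (Mem 13 0))
      (Forall 14 (Iff (Mem 14 13) (Interval 12 14)))))))) (parameters 0 0)"
  proof -
    have "\<exists>a. E a (vlevel 1) \<and> a \<notin> range \<nu> \<and>
        (\<forall>z. E z a \<longleftrightarrow> (\<exists>k. z = \<nu> k \<and> (\<exists>m'. \<nu> m = \<nu> m' \<and> 1 \<le> k \<and> k \<le> m')))" for m
      by (intro exI[of _ "vset (\<nu> ` {1..m})"])
        (use vset_nu(1)[of "{1..m}"] in \<open>auto simp: mem_vset_nu nu_eq_iff vset_nu_vlevel\<close>)
    then show ?thesis by (auto simp: sat_Interval mem_vnat)
  qed
  from transfer_parameters[OF this] assms show ?thesis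
    by (simp add: sat_hInterval mem_hypernats ext_def set_eq_iff)
qed

lemma difference_set:
  assumes "n \<in> hypernats" "a \<notin> hypernats" "ext F a \<subseteq> hyperfinite n"
  shows "\<exists>c. F c (star (vlevel 1)) \<and> c \<notin> hypernats \<and> ext F c = ext F a - ext F b"
proof -
  have "sat E (Forall 12 (Forall 13 (Forall 14 (Imp (Subset 13 12) (Ex 15 (Conj (Mem 15 11) (Conj (Neg (Mem 15 0))
      (Forall 16 (Iff (Mem 16 15) (Conj (Mem 16 13) (Neg (Mem 16 14)))))))))))) (parameters 0 0)"
  proof -
    have *: "\<exists>c. E c (vlevel 1) \<and> c \<notin> range \<nu> \<and>
        (\<forall>z. E z c \<longleftrightarrow> E z (vset (\<nu> ` S)) \<and> \<not> E z b)" for S b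
    proof (intro exI[of _ "vset (\<nu> ` {k \<in> S. \<not> E (\<nu> k) b})"] conjI allI)
      show "E (vset (\<nu> ` {k \<in> S. \<not> E (\<nu> k) b})) (vlevel 1)"
        by (simp add: vset_nu_vlevel)
    qed (use vset_nu(1) in \<open>auto simp: mem_vset_nu\<close>)
    show ?thesis
      by (simp add: sat_Subset mem_vnat) (use * in auto)
  qed
  from transfer_parameters[OF this] assms show ?thesis
    by (simp add: sat_hSubset mem_hypernats ext_def set_eq_iff)
qed

text \<open>\<open>internal_prob\<close> is composed of two descriptions. Existence and uniqueness
  of the cardinality and of the quotient are transferred, so both descriptions are proper.\<close>

lemma prob_unique:
  assumes n: "n \<in> hypernats" "hyperfinite n \<noteq> {}"
    and a: "a \<notin> hypernats" "ext F a \<subseteq> hyperfinite n"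
  shows "is_prob a n y \<longleftrightarrow> y = internal_prob n (ext F a)"
proof -
  \<comment> \<open>A nonempty interval means a positive denominator, without which
    \<open>vquotient\<close> has no value.\<close>
  have "sat E (Forall 12 (Forall 13 (Imp (Ex 14 (Interval 12 14)) (Imp (Subset 13 12)
     (Conj (Ex 14 (Forall 15 (Iff (Holds 3 13 15) (Eq 15 14))))
       (Ex 14 (Forall 15 (Iff (Prob 13 12 15) (Eq 15 14))))))))) (parameters 0 0)"
  proof -
    have card: "\<exists>x. \<forall>y. holds E (range \<nu>) vcard (vset (\<nu> ` S)) y \<longleftrightarrow> y = x"
      if "S \<subseteq> {Suc 0..m}" for S m
      using that finite_subset[OF that]
      by (intro exI[of _ "\<nu> (card S)"]) (auto simp: holds_vcard vset_nu_eq_iff)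
    have prob: "\<exists>x. \<forall>y. (\<exists>T. finite T \<and> vset (\<nu> ` S) = vset (\<nu> ` T) \<and>
       y = vreal (real (card T) / real m)) \<longleftrightarrow> y = x" if "S \<subseteq> {Suc 0..m}" for S m
      using that finite_subset[OF that]
      by (intro exI[of _ "vreal (real (card S) / real m)"]) (auto simp: vset_nu_eq_iff)
    show ?thesis
      by (auto simp: sat_Interval sat_Subset sat_Prob sat_Holds ext_vnat nu_eq_iff
          extends_parametersD(4)[OF extends_parameters_simps(1)] intro: card prob)
  qed
  from transfer_parameters[OF this]
  have "\<forall>n. hyperfinite n \<noteq> {} \<longrightarrow> (\<forall>a. n \<in> hypernats \<and> a \<notin> hypernats \<and> ext F a \<subseteq> hyperfinite n \<longrightarrow>
      (\<exists>k. \<forall>z. holds F hypernats (star vcard) a z \<longleftrightarrow> z = k) \<and> (\<exists>y. \<forall>z. is_prob a n z \<longleftrightarrow> z = y))"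
    by (simp add: sat_hInterval sat_hSubset sat_hProb hyper.sat_Holds ext_star_vnat ex_in_conv
      extends_hparametersD(4)[OF extends_hparameters_simps(1)])
  with assms have "\<exists>k. \<forall>z. holds F hypernats (star vcard) a z \<longleftrightarrow> z = k"
    "\<exists>y. \<forall>z. is_prob a n z \<longleftrightarrow> z = y" by simp_all
  then obtain k y' where k: "\<And>z. holds F hypernats (star vcard) a z \<longleftrightarrow> z = k"
    and y': "\<And>z. is_prob a n z \<longleftrightarrow> z = y'" by auto
  have "wset (ext F a) = a" by (rule hyper.mkset_eqI[OF a(1) refl])
  then have "internal_card (ext F a) = k"
    by (simp add: internal_card_def app_def k)
  then have "internal_prob n (ext F a) = (THE z. is_prob a n z)"
    by (simp add: internal_prob_def star_quotient_def app_def is_prob_def k)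
  then show ?thesis by (simp add: y')
qed

end

section \<open>Standard parts of internal probabilities\<close>

lemma sat_ForallD: "sat R (Forall i f) v \<Longrightarrow> sat R f (v(i := x))"
  by simp

context nonstandard_universe
begin

context
  fixes n :: 'w
  assumes n: "n \<in> hypernats" "hyperfinite n \<noteq> {}"
begin

text \<open>In the standard universe every probability is a real number in [0,1], so a formula that
  holds for all of these transfers to internal probabilities.\<close>

lemma prob_transfer:
  assumes f: "\<And>x a p. 0 \<le> p \<Longrightarrow> p \<le> 1 \<Longrightarrow>
      sat E f ((parameters s t)(12 := x, 13 := a, 14 := vreal p))"
    and a: "a \<notin> hypernats" "ext F a \<subseteq> hyperfinite n"
  shows "sat F f ((hparameters s t)(12 := n, 13 := a, 14 := internal_prob n (ext F a)))"
proof -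
  have "sat E (Forall 12 (Forall 13 (Forall 14 (Imp (Subset 13 12) (Imp (Prob 13 12 14) f))))) (parameters s t)"
    unfolding sat_connectives
  proof (intro allI impI)
    fix x a y
    let ?v = "(parameters s t)(12 := x, 13 := a, 14 := y)"
    assume "sat E (Subset 13 12) ?v"
    then obtain S m where S: "x = \<nu> m" "a = vset (\<nu> ` S)" "S \<subseteq> {1..m}"
      by (auto simp: sat_Subset)
    assume "sat E (Prob 13 12 14) ?v"
    then obtain T l where "l > 0" "a = vset (\<nu> ` T)" "x = \<nu> l"
      and y: "y = vreal (real (card T) / real l)"
      by (auto simp: sat_Prob)
    with S have "card T \<le> l"
      using card_mono[of "{1..m}" S] by (simp add: vset_nu_eq_iff nu_eq_iff)
    then show "sat E f ?v" using \<open>l > 0\<close> unfolding y by (intro f) auto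
  qed
  from transfer_parameters[OF this] a n(1) prob_unique[OF n a]
  show ?thesis by (simp add: sat_hSubset sat_hProb)
qed

context
  fixes a :: 'w
  assumes a: "a \<notin> hypernats" "ext F a \<subseteq> hyperfinite n"
begin

lemma prob_total:
  assumes "s < t"
  shows "star_less (star (vreal s)) (internal_prob n (ext F a)) \<or>
    star_less (internal_prob n (ext F a)) (star (vreal t))"
proof -
  have "sat F (Disj (Less 8 14) (Less 14 9)) ((hparameters s t)(12 := n, 13 := a, 14 := internal_prob n (ext F a)))"
    by (rule prob_transfer[OF _ a]) (use assms in \<open>auto simp: sat_Less vreal_eq_iff\<close>)
  then show ?thesis by (simp add: sat_hLess)
qed

lemma prob_consistent:
  assumes "star_less (star (vreal s)) (internal_prob n (ext F a))"
    "star_less (internal_prob n (ext F a)) (star (vreal t))"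
  shows "s < t"
proof (rule ccontr)
  assume "\<not> s < t"
  then have "sat F (Neg (Conj (Less 8 14) (Less 14 9)))
      ((hparameters s t)(12 := n, 13 := a, 14 := internal_prob n (ext F a)))"
    by (intro prob_transfer[OF _ a]) (auto simp: sat_Less vreal_eq_iff)
  then show False using assms by (simp add: sat_hLess)
qed

lemma prob_above_negative: "star_less (star (vreal s)) (internal_prob n (ext F a))" if "s < 0"
proof -
  have "sat F (Less 8 14) ((hparameters s 0)(12 := n, 13 := a, 14 := internal_prob n (ext F a)))"
    by (rule prob_transfer[OF _ a]) (use that in \<open>auto simp: sat_Less vreal_eq_iff\<close>)
  then show ?thesis by (simp add: sat_hLess)
qed

lemma prob_below: "star_less (internal_prob n (ext F a)) (star (vreal t))" if "1 < t"
proof -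
  have "sat F (Less 14 9) ((hparameters 0 t)(12 := n, 13 := a, 14 := internal_prob n (ext F a)))"
    by (rule prob_transfer[OF _ a]) (use that in \<open>auto simp: sat_Less vreal_eq_iff\<close>)
  then show ?thesis by (simp add: sat_hLess)
qed

text \<open>The description in \<open>st\<close> is proper: totality and consistency are the
  hypotheses of \<open>real_cut\<close>, with -1 and 2 as bounds outside [0,1].\<close>

lemma st_prob:
  "\<forall>e>0. star_less (star (vreal (st (internal_prob n (ext F a)) - e))) (internal_prob n (ext F a)) \<and>
     star_less (internal_prob n (ext F a)) (star (vreal (st (internal_prob n (ext F a)) + e)))"
proof -
  have "star_less (star (vreal (- 1))) (internal_prob n (ext F a))"
    "star_less (internal_prob n (ext F a)) (star (vreal 2))"
    by (simp_all add: prob_above_negative prob_below)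
  with real_cut[of "\<lambda>s. star_less (star (vreal s)) (internal_prob n (ext F a))"
      "\<lambda>s. star_less (internal_prob n (ext F a)) (star (vreal s))"]
  have "\<exists>!r. \<forall>e>0. star_less (star (vreal (r - e))) (internal_prob n (ext F a)) \<and>
      star_less (internal_prob n (ext F a)) (star (vreal (r + e)))"
    using prob_total prob_consistent by blast
  then show ?thesis unfolding st_def by (rule theI')
qed

lemma less_st_probD:
  "s < st (internal_prob n (ext F a)) \<Longrightarrow> star_less (star (vreal s)) (internal_prob n (ext F a))"
  using st_prob[rule_format, of "st (internal_prob n (ext F a)) - s"] by simp

lemma st_prob_lessD:
  "st (internal_prob n (ext F a)) < s \<Longrightarrow> star_less (internal_prob n (ext F a)) (star (vreal s))"
  using st_prob[rule_format, of "s - st (internal_prob n (ext F a))"] by simp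

text \<open>Only a weak inequality remains, since the probability may exceed s by an
  infinitesimal.\<close>

lemma star_less_le_st:
  assumes "star_less (star (vreal s)) (internal_prob n (ext F a))"
  shows "s \<le> st (internal_prob n (ext F a))"
proof (rule ccontr)
  assume "\<not> ?thesis"
  then have "star_less (internal_prob n (ext F a)) (star (vreal s))" by (intro st_prob_lessD) simp
  then show False using prob_consistent[OF assms, of s] by simp
qed

lemma st_le_star_less:
  assumes "star_less (internal_prob n (ext F a)) (star (vreal s))"
  shows "st (internal_prob n (ext F a)) \<le> s"
proof (rule ccontr)
  assume "\<not> ?thesis"
  then have "star_less (star (vreal s)) (internal_prob n (ext F a))" by (intro less_st_probD) simp
  then show False using prob_consistent[OF _ assms, of s] by simp
qed

lemma st_prob_nonneg: "0 \<le> st (internal_prob n (ext F a))"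
proof (rule field_le_epsilon)
  fix e :: real assume "e > 0"
  then have "- e \<le> st (internal_prob n (ext F a))"
    by (intro star_less_le_st prob_above_negative) simp
  then show "0 \<le> st (internal_prob n (ext F a)) + e" by simp
qed

end

text \<open>Additivity is transferred as implications between strict bounds by standard reals, so
  that no sum of hyperreals has to be formed. Bounds within e / 2 of the standard parts then give
  both inequalities.\<close>

lemma st_prob_additive:
  assumes a: "a \<notin> hypernats" "ext F a \<subseteq> hyperfinite n"
    and b: "b \<notin> hypernats" "ext F b \<subseteq> hyperfinite n"
    and c: "c \<notin> hypernats" "ext F c = ext F a \<union> ext F b" "ext F a \<inter> ext F b = {}"
  shows "st (internal_prob n (ext F c)) = st (internal_prob n (ext F a)) + st (internal_prob n (ext F b))"
proof -
  have c': "ext F c \<subseteq> hyperfinite n" using a b c by simp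
  have transfer: "(star_less (star (vreal s)) (internal_prob n (ext F a)) \<and>
      star_less (star (vreal t)) (internal_prob n (ext F b)) \<longrightarrow>
      star_less (star (vreal (s + t))) (internal_prob n (ext F c))) \<and>
    (star_less (internal_prob n (ext F a)) (star (vreal s)) \<and>
      star_less (internal_prob n (ext F b)) (star (vreal t)) \<longrightarrow>
      star_less (internal_prob n (ext F c)) (star (vreal (s + t))))" for s t
  proof -
    let ?f = "Imp (Subset 13 12) (Imp (Subset 14 12) (Imp (Subset 15 12)
      (Imp (Forall 16 (Iff (Mem 16 15) (Disj (Mem 16 13) (Mem 16 14))))
      (Imp (Forall 16 (Neg (Conj (Mem 16 13) (Mem 16 14))))
      (Imp (Prob 13 12 17) (Imp (Prob 14 12 18) (Imp (Prob 15 12 19)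
      (Conj (Imp (Conj (Less 8 17) (Less 9 18)) (Less 10 19))
        (Imp (Conj (Less 17 8) (Less 18 9)) (Less 19 10))))))))))"
    have "sat E (Forall 12 (Forall 13 (Forall 14 (Forall 15 (Forall 17 (Forall 18 (Forall 19 ?f))))))) (parameters s t)"
    proof -
      have sum: "\<forall>m. real (card W) / real m = real (card S) / real m + real (card T) / real m"
        if "finite S" "finite T" "\<forall>z. z \<in> \<nu> ` W \<longleftrightarrow> z \<in> \<nu> ` S \<or> z \<in> \<nu> ` T"
          "\<forall>z. z \<in> \<nu> ` S \<longrightarrow> z \<notin> \<nu> ` T" for S T W :: "nat set"
      proof -
        have "W = S \<union> T" "S \<inter> T = {}"
          using that(3)[rule_format, of "\<nu> _"] that(4)[rule_format, of "\<nu> _"]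
          by (auto simp: inj_image_mem_iff[OF inj_nu])
        then show ?thesis using that(1,2) by (simp add: card_Un_disjoint add_divide_distrib)
      qed
      show ?thesis
        by (clarsimp simp: sat_Subset sat_Prob sat_Less vset_nu_eq_iff nu_eq_iff vreal_eq_iff
            mem_vset_nu, drule (3) sum, auto)
    qed
    from transfer_parameters[OF this]
    have "sat F ?f ((hparameters s t)(12 := n, 13 := a, 14 := b, 15 := c, 17 := internal_prob n (ext F a),
        18 := internal_prob n (ext F b), 19 := internal_prob n (ext F c)))"
      by (intro sat_ForallD)
    moreover have "\<forall>x. F x c \<longleftrightarrow> F x a \<or> F x b" "\<forall>x. F x a \<longrightarrow> \<not> F x b"
      using c(2,3) by (auto simp: ext_def)
    ultimately show ?thesis
      using n a b c(1) c' prob_unique[OF n a] prob_unique[OF n b] prob_unique[OF n c(1) c']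
      by (simp add: sat_hSubset sat_hProb sat_hLess)
  qed
  let ?A = "st (internal_prob n (ext F a))" and ?B = "st (internal_prob n (ext F b))"
    and ?C = "st (internal_prob n (ext F c))"
  have "?A + ?B \<le> ?C"
  proof (rule field_le_epsilon)
    fix e :: real assume "e > 0"
    then have "star_less (star (vreal (?A - e / 2))) (internal_prob n (ext F a))"
      "star_less (star (vreal (?B - e / 2))) (internal_prob n (ext F b))"
      by (intro less_st_probD a b; simp)+
    then have "?A - e / 2 + (?B - e / 2) \<le> ?C"
      by (intro star_less_le_st c(1) c' transfer[THEN conjunct1, rule_format] conjI)
    then show "?A + ?B \<le> ?C + e" by simp
  qed
  moreover have "?C \<le> ?A + ?B"
  proof (rule field_le_epsilon)
    fix e :: real assume "e > 0"
    then have "star_less (internal_prob n (ext F a)) (star (vreal (?A + e / 2)))"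
      "star_less (internal_prob n (ext F b)) (star (vreal (?B + e / 2)))"
      by (intro st_prob_lessD a b; simp)+
    then have "?C \<le> ?A + e / 2 + (?B + e / 2)"
      by (intro st_le_star_less c(1) c' transfer[THEN conjunct2, rule_format] conjI)
    then show "?C \<le> ?A + ?B + e" by simp
  qed
  ultimately show ?thesis by simp
qed

end

end

section \<open>The Loeb measure\<close>

context nonstandard_universe
begin

text \<open>Nonstandard indices i are allowed too, which makes the index set as large as
  \<Omega>.\<close>

definition walsh_set :: "'w \<Rightarrow> 'w \<Rightarrow> 'w set" where
  "walsh_set n i = {x \<in> hyperfinite n. holds F hypernats (star vwalsh) i x}"

lemma walsh_set_ext:
  assumes "n \<in> hypernats"
  shows "\<exists>a. F a (star (vlevel 1)) \<and> a \<notin> hypernats \<and> ext F a = walsh_set n i"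
proof -
  have "sat E (Forall 12 (Imp (Mem 12 0) (Forall 13 (Ex 14 (Conj (Mem 14 11) (Conj (Neg (Mem 14 0))
      (Forall 15 (Iff (Mem 15 14) (Conj (Interval 12 15) (Holds 6 13 15)))))))))) (parameters 0 0)"
  proof -
    have "\<exists>a. E a (vlevel 1) \<and> a \<notin> range \<nu> \<and>
        (\<forall>z. E z a \<longleftrightarrow> (\<exists>k. z = \<nu> k \<and> (\<exists>m'. \<nu> m = \<nu> m' \<and> 1 \<le> k \<and> k \<le> m')) \<and>
          holds E (range \<nu>) vwalsh i z)" for m i
      by (intro exI[of _ "vset (\<nu> ` {k \<in> {1..m}. holds E (range \<nu>) vwalsh i (\<nu> k)})"])
        (use vset_nu(1) in \<open>auto simp: mem_vset_nu nu_eq_iff vset_nu_vlevel\<close>)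
    then show ?thesis
      by (auto simp: sat_Interval sat_Holds ext_vnat mem_vnat)
  qed
  from transfer_parameters[OF this] assms show ?thesis
    by (simp add: sat_hInterval hyper.sat_Holds ext_star_vnat mem_hypernats walsh_set_def
        ext_def set_eq_iff)
qed

text \<open>This is the transfer of \<open>walsh_separated\<close>, with the bound 1 / 4 expressed
  through the standard reals s below it.\<close>

lemma walsh_set_less:
  assumes n: "n \<in> hypernats"
    and ijk: "i \<in> hyperfinite n" "j \<in> hyperfinite n" "k \<in> hyperfinite n" "i \<noteq> j" "i \<noteq> k" "j \<noteq> k"
    and a: "a \<notin> hypernats" "ext F a = sym_diff (walsh_set n i) (walsh_set n j)"
    and b: "b \<notin> hypernats" "ext F b = sym_diff (walsh_set n i) (walsh_set n k)"
    and "s < 1 / 4"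
  shows "star_less (star (vreal s)) (internal_prob n (ext F a)) \<or>
    star_less (star (vreal s)) (internal_prob n (ext F b))"
proof -
  let ?diff = "\<lambda>d i j. Conj (Subset d 12)
    (Forall 20 (Iff (Mem 20 d) (Conj (Interval 12 20) (Neg (Iff (Holds 6 i 20) (Holds 6 j 20))))))"
  let ?f = "Imp (Interval 12 13) (Imp (Interval 12 14) (Imp (Interval 12 15)
    (Imp (Neg (Eq 13 14)) (Imp (Neg (Eq 13 15)) (Imp (Neg (Eq 14 15))
    (Imp (?diff 16 13 14) (Imp (?diff 17 13 15) (Imp (Prob 16 12 18) (Imp (Prob 17 12 19)
    (Disj (Less 8 18) (Less 8 19)))))))))))"
  have "sat E (Forall 12 (Forall 13 (Forall 14 (Forall 15 (Forall 16 (Forall 17 (Forall 18 (Forall 19 ?f))))))))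
    (parameters s 0)"
  proof -
    have far: "s < real (card S) / real m \<or> s < real (card T) / real m"
      if "Suc 0 \<le> i" "i \<le> m" "Suc 0 \<le> j" "j \<le> m" "Suc 0 \<le> k" "k \<le> m" "i \<noteq> j" "i \<noteq> k" "j \<noteq> k"
        "S = {x \<in> {1..m}. walsh i x \<noteq> walsh j x}" "T = {x \<in> {1..m}. walsh i x \<noteq> walsh k x}"
      for i j k m S T
    proof -
      have "m > 0" using that(1,2) by simp
      have "m \<le> 4 * card S \<or> m \<le> 4 * card T"
        using walsh_separated[of i m j k] that by simp
      then have "1 / 4 \<le> real (card S) / real m \<or> 1 / 4 \<le> real (card T) / real m"
        using \<open>m > 0\<close> by (auto simp: field_simps)
      then show ?thesis using \<open>s < 1 / 4\<close> by linarith
    qed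
    have diff: "S = {x \<in> {1..m}. walsh i x \<noteq> walsh j x}"
      if "\<forall>x. (x \<in> \<nu> ` S) = ((\<exists>k. x = \<nu> k \<and> Suc 0 \<le> k \<and> k \<le> m) \<and>
        (\<exists>k. x = \<nu> k \<and> walsh i k) = (\<forall>k. x = \<nu> k \<longrightarrow> \<not> walsh j k))" for S i j m
      using that[rule_format, of "\<nu> _"] by (auto simp: inj_image_mem_iff[OF inj_nu] nu_eq_iff)
    show ?thesis
      by (clarsimp simp: sat_Interval sat_Subset sat_Prob sat_Less sat_Holds ext_vnat
          vset_nu_eq_iff nu_eq_iff vreal_eq_iff mem_vset_nu holds_vwalsh,
        drule diff, drule diff, drule (10) far, simp)
  qed
  from transfer_parameters[OF this]
  have "sat F ?f ((hparameters s 0)(12 := n, 13 := i, 14 := j, 15 := k, 16 := a, 17 := b,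
      18 := internal_prob n (ext F a), 19 := internal_prob n (ext F b)))"
    by (intro sat_ForallD)
  moreover have sub: "ext F a \<subseteq> hyperfinite n" "ext F b \<subseteq> hyperfinite n"
    unfolding a b by (auto simp: walsh_set_def)
  moreover have "\<forall>x. F x a \<longleftrightarrow> x \<in> hyperfinite n \<and>
      (holds F hypernats (star vwalsh) i x \<longleftrightarrow> \<not> holds F hypernats (star vwalsh) j x)"
    "\<forall>x. F x b \<longleftrightarrow> x \<in> hyperfinite n \<and>
      (holds F hypernats (star vwalsh) i x \<longleftrightarrow> \<not> holds F hypernats (star vwalsh) k x)"
    using a(2) b(2) by (auto simp: ext_def walsh_set_def)
  moreover have "hyperfinite n \<noteq> {}" using ijk by auto
  ultimately show ?thesis
    using n a(1) b(1) ijk prob_unique[OF n _ a(1) sub(1)] prob_unique[OF n _ b(1) sub(2)]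
    by (simp add: sat_hInterval sat_hSubset sat_hProb sat_hLess hyper.sat_Holds ext_star_vnat)
qed

lemma internal_ext: "F a (star (vlevel 1)) \<Longrightarrow> a \<notin> hypernats \<Longrightarrow> internal (ext F a)"
  unfolding internal_def nonstandard_part_def by (auto simp: ext_def)

lemma internalE:
  assumes "internal A"
  obtains a where "a \<notin> hypernats" "ext F a = A"
  using assms by (auto simp: internal_def)

lemma internal_walsh_set: "n \<in> hypernats \<Longrightarrow> internal (walsh_set n i)"
  using walsh_set_ext[of n i] internal_ext by metis

lemma internal_hyperfinite: "n \<in> hypernats \<Longrightarrow> internal (hyperfinite n)"
  using hyperfinite_set[of n] internal_ext by metis

lemma internal_Diff:
  assumes "n \<in> hypernats" "internal A" "A \<subseteq> hyperfinite n" "internal B"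
  shows "internal (A - B)"
proof -
  obtain a b where ab: "a \<notin> hypernats" "ext F a = A" "ext F b = B"
    using internalE assms(2,4) by metis
  then obtain c where "F c (star (vlevel 1))" "c \<notin> hypernats" "ext F c = A - B"
    using difference_set[OF assms(1), of a b] assms(3) by auto
  then show ?thesis using internal_ext[of c] by simp
qed

lemma internal_Un:
  assumes n: "n \<in> hypernats" and A: "internal A" "A \<subseteq> hyperfinite n"
    and B: "internal B" "B \<subseteq> hyperfinite n"
  shows "internal (A \<union> B)"
proof -
  \<comment> \<open>Unions are expressed through differences, for which internality has already been
    transferred.\<close>
  have "internal (hyperfinite n - (hyperfinite n - A - B))"
    by (intro internal_Diff[OF n] internal_hyperfinite n A B) auto
  also have "hyperfinite n - (hyperfinite n - A - B) = A \<union> B" using A(2) B(2) by auto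
  finally show ?thesis .
qed

lemma ring_internal:
  assumes "n \<in> hypernats"
  shows "ring_of_sets (hyperfinite n) {A. internal A \<and> A \<subseteq> hyperfinite n}"
proof (rule ring_of_setsI)
  show "{} \<in> {A. internal A \<and> A \<subseteq> hyperfinite n}"
    using internal_Diff[OF assms internal_hyperfinite[OF assms] subset_refl internal_hyperfinite[OF assms]]
    by simp
qed (use internal_Un[OF assms] internal_Diff[OF assms] in auto)

text \<open>A decreasing sequence of nonempty sets has the finite intersection property, so
  saturation provides a common point.\<close>

lemma decseq_internal_empty:
  assumes A: "decseq A" "\<And>i. internal (A i)" "(\<Inter>i. A i) = {}"
  shows "\<exists>i. A i = {}"
proof (rule ccontr)
  assume nonempty: "\<not> ?thesis"
  have "fip (range A)"
    unfolding fip_def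
  proof (intro allI impI)
    fix X assume X: "finite X" "X \<noteq> {}" "X \<subseteq> range A"
    then obtain I where I: "finite I" "X = A ` I" by (metis finite_subset_image)
    then have "I \<noteq> {}" using X(2) by auto
    then have "A (Max I) \<subseteq> \<Inter>X"
      using I A(1) by (auto simp: decseq_def dest!: Max_ge)
    then show "\<Inter>X \<noteq> {}" using nonempty by blast
  qed
  then have "\<Inter>(range A) \<noteq> {}" using A(2) by (intro omega1_saturated) auto
  then show False using A(3) by simp
qed

section \<open>The Loeb measure of a hyperfinite set and the distances of its Walsh sets\<close>

context
  fixes H :: 'w
  assumes H: "H \<in> hypernats" "hyperfinite H \<noteq> {}"
begin

lemma st_prob_Un:
  assumes "internal A" "A \<subseteq> hyperfinite H" "internal B" "B \<subseteq> hyperfinite H" "A \<inter> B = {}"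
  shows "st (internal_prob H (A \<union> B)) = st (internal_prob H A) + st (internal_prob H B)"
proof -
  obtain a b c where "a \<notin> hypernats" "ext F a = A" "b \<notin> hypernats" "ext F b = B"
    "c \<notin> hypernats" "ext F c = A \<union> B"
    using internalE[OF assms(1)] internalE[OF assms(3)] internalE[OF internal_Un[OF H(1) assms(1-4)]]
    by metis
  then show ?thesis using st_prob_additive[OF H, of a b c] assms by simp
qed

lemma st_prob_ge_0:
  assumes "internal A" "A \<subseteq> hyperfinite H"
  shows "0 \<le> st (internal_prob H A)"
  using internalE[OF assms(1)] st_prob_nonneg[OF H] assms(2) by metis

lemma st_prob_empty: "st (internal_prob H {}) = 0"
proof -
  have "internal {}"
    using internal_Diff[OF H(1) internal_hyperfinite[OF H(1)] subset_refl internal_hyperfinite[OF H(1)]]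
    by simp
  then show ?thesis using st_prob_Un[of "{}" "{}"] by simp
qed

text \<open>Loeb's construction: a decreasing sequence of internal sets with empty intersection is
  eventually empty, so the premeasure is trivially continuous at the empty set and Caratheodory's
  theorem applies.\<close>

lemma loeb_extension:
  "\<exists>\<mu> :: 'w set \<Rightarrow> ennreal. (\<forall>A \<in> {A. internal A \<and> A \<subseteq> hyperfinite H}. \<mu> A = ennreal (st (internal_prob H A))) \<and>
    measure_space (hyperfinite H) (sigma_sets (hyperfinite H) {A. internal A \<and> A \<subseteq> hyperfinite H}) \<mu>"
proof (rule ring_of_sets.caratheodory_empty_continuous[OF ring_internal[OF H(1)]])
  let ?I = "{A. internal A \<and> A \<subseteq> hyperfinite H}"
  let ?\<mu> = "\<lambda>A. ennreal (st (internal_prob H A))"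
  show "positive ?I ?\<mu>" by (simp add: positive_def st_prob_empty)
  show "additive ?I ?\<mu>"
    unfolding additive_def by (auto simp: st_prob_Un st_prob_ge_0 ennreal_plus)
  show "?\<mu> A \<noteq> \<infinity>" for A by simp
  show "(\<lambda>i. ?\<mu> (A i)) \<longlonglongrightarrow> 0" if A: "range A \<subseteq> ?I" "decseq A" "(\<Inter>i. A i) = {}" for A
  proof -
    obtain N where "A N = {}" using decseq_internal_empty[OF A(2) _ A(3)] A(1) by auto
    have "A i = {}" if "i \<ge> N" for i
      using decseqD[OF A(2) that] \<open>A N = {}\<close> by simp
    then have "\<forall>\<^sub>F i in sequentially. ?\<mu> (A i) = 0"
      by (intro eventually_sequentiallyI[of N]) (simp add: st_prob_empty)
    then show ?thesis by (rule tendsto_eventually)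
  qed
qed

lemma
  shows space_loeb: "space (loeb_space H) = hyperfinite H"
    and sets_loeb: "internal A \<Longrightarrow> A \<subseteq> hyperfinite H \<Longrightarrow> A \<in> sets (loeb_space H)"
    and emeasure_loeb: "internal A \<Longrightarrow> A \<subseteq> hyperfinite H \<Longrightarrow>
      emeasure (loeb_space H) A = ennreal (st (internal_prob H A))"
proof -
  let ?I = "{A. internal A \<and> A \<subseteq> hyperfinite H}"
  let ?M = "extend_measure (hyperfinite H) ?I (\<lambda>A. A) (\<lambda>A. ennreal (st (internal_prob H A)))"
  have sub: "(\<lambda>A. A) ` ?I \<subseteq> Pow (hyperfinite H)" by auto
  have sets: "sets ?M = sigma_sets (hyperfinite H) ?I"
    using sets_extend_measure[OF sub] by simp
  show "space (loeb_space H) = hyperfinite H"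
    unfolding loeb_space_def using space_extend_measure[OF sub] by simp
  assume A: "internal A" "A \<subseteq> hyperfinite H"
  then have AM: "A \<in> sets ?M" unfolding sets by (intro sigma_sets.Basic) simp
  then show "A \<in> sets (loeb_space H)"
    unfolding loeb_space_def by (rule sets_completionI_sets)
  \<comment> \<open>The values of \<open>extend_measure\<close> can be identified once some measure
    extending the premeasure is known.\<close>
  obtain \<mu> :: "'w set \<Rightarrow> ennreal" where \<mu>: "\<forall>A \<in> ?I. \<mu> A = ennreal (st (internal_prob H A))"
    "measure_space (hyperfinite H) (sigma_sets (hyperfinite H) ?I) \<mu>"
    using loeb_extension by blast
  have "emeasure ?M A = ennreal (st (internal_prob H A))"
    by (rule emeasure_extend_measure[OF refl, where \<mu>' = \<mu> and G = "\<lambda>A. A"])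
      (use \<mu> sub A in \<open>auto simp: sets measure_space_def\<close>)
  then show "emeasure (loeb_space H) A = ennreal (st (internal_prob H A))"
    unfolding loeb_space_def by (simp add: AM)
qed

lemma finite_loeb: "finite_measure (loeb_space H)"
  by (rule finite_measureI) (simp add: space_loeb emeasure_loeb internal_hyperfinite H)

lemma walsh_set_far:
  assumes "i \<in> hyperfinite H" "j \<in> hyperfinite H" "k \<in> hyperfinite H" "i \<noteq> j" "i \<noteq> k" "j \<noteq> k"
  shows "1 / 4 \<le> measure (loeb_space H) (sym_diff (walsh_set H i) (walsh_set H j)) \<or>
    1 / 4 \<le> measure (loeb_space H) (sym_diff (walsh_set H i) (walsh_set H k))"
proof -
  have sub: "walsh_set H i \<subseteq> hyperfinite H" for i by (auto simp: walsh_set_def)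
  have int: "internal (sym_diff (walsh_set H i) (walsh_set H j))" for i j
    using sub by (intro internal_Un[OF H(1)] internal_Diff[OF H(1)] internal_walsh_set H) auto
  have measure: "measure (loeb_space H) (sym_diff (walsh_set H i) (walsh_set H j)) =
      st (internal_prob H (sym_diff (walsh_set H i) (walsh_set H j)))" for i j
    unfolding measure_def using sub[of i] sub[of j]
    by (subst emeasure_loeb[OF int]) (auto intro!: enn2real_ennreal st_prob_ge_0[OF int])
  obtain a where a: "a \<notin> hypernats" "ext F a = sym_diff (walsh_set H i) (walsh_set H j)"
    by (rule internalE[OF int])
  obtain b where b: "b \<notin> hypernats" "ext F b = sym_diff (walsh_set H i) (walsh_set H k)"
    by (rule internalE[OF int])
  have sub': "ext F a \<subseteq> hyperfinite H" "ext F b \<subseteq> hyperfinite H"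
    unfolding a b using sub by blast+
  have "s \<le> st (internal_prob H (ext F a)) \<or> s \<le> st (internal_prob H (ext F b))" if "s < 1 / 4" for s
    using walsh_set_less[OF H(1) assms a b that] star_less_le_st[OF H a(1) sub'(1)]
      star_less_le_st[OF H b(1) sub'(2)] by blast
  \<comment> \<open>Which alternative holds may depend on s; the maximum of the two numbers bounds
    every s below 1 / 4, hence is at least 1 / 4.\<close>
  then have "\<not> max (st (internal_prob H (ext F a))) (st (internal_prob H (ext F b))) < 1 / 4"
    by (metis dense max_less_iff_conj not_le)
  then show ?thesis unfolding a(2) b(2) measure by linarith
qed

text \<open>Two Walsh sets within 1 / 8 of \<open>G\<close> are within 1 / 4 of each other, which by
  \<open>walsh_set_far\<close> excludes three such indices.\<close>

lemma walsh_set_separated: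
  assumes G: "G \<in> sets (loeb_space H)"
  shows "finite {i \<in> hyperfinite H. measure (loeb_space H) (sym_diff (walsh_set H i) G) < 1 / 8}"
    (is "finite ?S")
proof (rule ccontr)
  interpret finite_measure "loeb_space H" by (rule finite_loeb)
  have W: "walsh_set H i \<in> sets (loeb_space H)" for i
    by (intro sets_loeb internal_walsh_set H) (auto simp: walsh_set_def)
  have close: "measure (loeb_space H) (sym_diff (walsh_set H i) (walsh_set H j)) < 1 / 4"
    if "i \<in> ?S" "j \<in> ?S" for i j
  proof -
    have "measure (loeb_space H) (sym_diff (walsh_set H i) (walsh_set H j)) \<le>
      measure (loeb_space H) (sym_diff (walsh_set H i) G \<union> sym_diff (walsh_set H j) G)"
      using W G by (intro finite_measure_mono) auto
    also have "\<dots> \<le> measure (loeb_space H) (sym_diff (walsh_set H i) G) +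
        measure (loeb_space H) (sym_diff (walsh_set H j) G)"
      using W G by (intro measure_Un_le) auto
    finally show ?thesis using that by simp
  qed
  assume "infinite ?S"
  then obtain T where "finite T" "card T = 3" "T \<subseteq> ?S"
    using infinite_arbitrarily_large by blast
  then obtain i j k where "i \<in> ?S" "j \<in> ?S" "k \<in> ?S" "i \<noteq> j" "i \<noteq> k" "j \<noteq> k"
    by (auto simp: card_3_iff)
  then show False
    using walsh_set_far[of i j k] close[of i j] close[of i k] by auto
qed

end

end

theorem theorem9:
  fixes E :: "'v \<Rightarrow> 'v \<Rightarrow> bool" and \<nu> :: "nat \<Rightarrow> 'v"
    and F :: "'w \<Rightarrow> 'w \<Rightarrow> bool" and star :: "'v \<Rightarrow> 'w"
    and H :: 'w and r :: "'l rel"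
  assumes regular: "Cinfinite r" "regularCard r"
    and power_less: "\<forall>\<kappa> :: 'l rel. Card_order \<kappa> \<and> \<kappa> <o r \<longrightarrow> \<kappa> ^c natLeq <o r"
    and universe: "nonstandard_universe E \<nu> F star"
    and infinite: "H \<in> elementary_extension.infinite_hypernats E \<nu> F star"
    and cardinality: "|nonstandard_universe.hyperfinite E \<nu> F star H| =o r"
  shows "\<not> compact_measure_space (nonstandard_universe.loeb_space E \<nu> F star H)"
proof -
  interpret regular_omega_closed r
    using regular power_less by unfold_locales
  interpret nonstandard_universe E \<nu> F star by (rule universe)
  have "H \<in> hypernats" using infinite by (simp add: infinite_hypernats_def)
  \<comment> \<open>Finite sets are small, whereas \<Omega> has cardinality \<lambda>.\<close>
  moreover have "hyperfinite H \<noteq> {}"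
    using cardinality not_ordLess_ordIso[OF small_finite[of "hyperfinite H"]] by auto
  ultimately show ?thesis
  proof (intro not_compact[where I = "hyperfinite H" and A = "walsh_set H" and \<epsilon> = "1 / 8"])
    assume H: "H \<in> hypernats" "hyperfinite H \<noteq> {}"
    show "finite_measure (loeb_space H)" by (rule finite_loeb[OF H])
    show "|space (loeb_space H)| =o r" unfolding space_loeb[OF H] by (rule cardinality)
    show "walsh_set H i \<in> sets (loeb_space H)" for i
      by (intro sets_loeb[OF H] internal_walsh_set H(1)) (auto simp: walsh_set_def)
    show "finite {i \<in> hyperfinite H. measure (loeb_space H) (sym_diff (walsh_set H i) G) < 1 / 8}"
      if "G \<in> sets (loeb_space H)" for G
      using that by (rule walsh_set_separated[OF H])
  qed (use cardinality in auto)
qed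

end
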